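(* There exist functions $k_0(q,\epsilon)$, $d(q,\epsilon)<\infty$ and $\tau(q,\epsilon)>0$, defined for $q\in\mathbb Z^+$ and $\epsilon>0$, with $k_0(q,\epsilon)\ge\Omega_\epsilon(\sqrt q)$ (i.e. for each $\epsilon>0$ there is $c_\epsilon>0$ with $k_0(q,\epsilon)\ge c_\epsilon\sqrt q$ for all $q$), such that the following holds. For every $\epsilon>0$, all $k,q\in\mathbb Z^+$ and every sufficiently large $n$: if $k<k_0(q,\epsilon)$ and $f:\{0,1\}^n\to K_A^{(k)}$ and $g:\{0,1\}^n\to K_B^{(k)}$ are functions with $\mathrm{success}_{(\mathcal Y,\mathcal N)}(f,g)\ge\epsilon$, then there exists $i\in[n]$ such that $$\min\Big\{\max_{j\in[2^k]}\mathrm{Inf}_i^{\le d(q,\epsilon)}(f_j),\ \max_{j\in[2^k]}\mathrm{Inf}_i^{\le d(q,\epsilon)}(g_j)\Big\}\ge\tau(q,\epsilon),$$ where $f_j,g_j$ denote the $j$-th coordinate functions of $f,g$, the influences of $f_j$ are with respect to the product distribution $\mathrm{Bern}(1/q)^{\otimes n}$ on $\{0,1\}^n$, and those of $g_j$ with respect to the uniform distribution on $\{0,1\}^n$.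
   Context: Strategy sets: vectors $x\in[0,1]^{2^k}$ are indexed by $\{0,1\}^k$. For such $x$ define for $0\le j\le k$ and $i_1,\dots,i_j\in\{0,1\}$: $\hat x_A(i_1,\dots,i_k)=\hat x_B(i_1,\dots,i_k)=x(i_1,\dots,i_k)$; for $j<k$: $\hat x_A(i_1..i_j)=\hat x_A(i_1..i_j,0)+\hat x_A(i_1..i_j,1)$ if $j$ even and $=\frac12(\hat x_A(i_1..i_j,0)+\hat x_A(i_1..i_j,1))$ if $j$ odd; $\hat x_B(i_1..i_j)=\frac12(\hat x_B(\dots,0)+\hat x_B(\dots,1))$ if $j$ even and $=\hat x_B(\dots,0)+\hat x_B(\dots,1)$ if $j$ odd. $\tilde K_A=\{x:\hat x_A()=1$, and $\hat x_A(i_1..i_j,0)=\hat x_A(i_1..i_j,1)$ for all odd $j<k$ and all $i_1..i_j\}$; $\tilde K_B=\{x:\hat x_B()=1$, and $\hat x_B(i_1..i_j,0)=\hat x_B(i_1..i_j,1)$ for all even $j<k\}$. With $v(i_1,\dots,i_k)=i_k$ and $\ast$ the coordinatewise product, $K_A^{(k)}=\{x\ast v:x\in\tilde K_A\}$, $K_B^{(k)}=\{x\ast v:x\in\tilde K_B\}$. (These are exactly the vector representations of probabilistic $k$-bit strategies, with $\langle x_A,x_B\rangle$ the acceptance probability.) Distributions: $B_N$ on $\{0,1\}^2$: $x\sim\mathrm{Bern}(1/q)$ and $y$ uniform, independent. $B_Y$ on $\{0,1\}^2$: $(x,y)=(0,1)$ w.p. $\frac12(1-\frac{1.95}q)$,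 $(0,0)$ w.p. $\frac12(1-\frac{0.05}q)$, $(1,1)$ w.p. $\frac{1.95}{2q}$, $(1,0)$ w.p. $\frac{0.05}{2q}$. $\mathcal Y=B_Y^{\otimes n}$, $\mathcal N=B_N^{\otimes n}$ on $(\{0,1\}\times\{0,1\})^n$. $\mathrm{success}_{(\mathcal Y,\mathcal N)}(f,g)=\mathbb E_{(x,y)\sim\mathcal Y}\langle f(x),g(y)\rangle-\mathbb E_{(x,y)\sim\mathcal N}\langle f(x),g(y)\rangle$. Low-degree influence: for a probability $\mu$ on $\{0,1\}$ with $\mu(1)=p\in(0,1)$, let $\chi(z)=(z-p)/\sqrt{p(1-p)}$; every $h:\{0,1\}^n\to\mathbb R$ has a unique expansion $h(z)=\sum_{S\subseteq[n]}\hat h(S)\prod_{i\in S}\chi(z_i)$, and $\mathrm{Inf}_i^{\le d}(h)=\sum_{S\ni i,|S|\le d}\hat h(S)^2$. *)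

theory Defs
  imports "HOL-Probability.Probability"
begin

section \<open>Vector representations of probabilistic \<open>k\<close>-bit strategies\<close>

text \<open>
  The index set \<open>{0,1}\<^sup>k\<close> consists of the Boolean lists of length \<open>k\<close>, with \<open>i\<^sub>1\<close> at the head;
  vectors are functions on Boolean lists that are extensional on \<open>bitstrings k\<close>.
\<close>

definition bitstrings :: "nat \<Rightarrow> bool list set" where
  "bitstrings k = {l. length l = k}"

function hatA :: "nat \<Rightarrow> (bool list \<Rightarrow> real) \<Rightarrow> bool list \<Rightarrow> real" where
  "hatA k x l =
     (if length l < k then
        (if even (length l)
         then hatA k x (l @ [False]) + hatA k x (l @ [True])
         else (hatA k x (l @ [False]) + hatA k x (l @ [True])) / 2)
      else x l)"
  by auto
termination by (relation "Wellfounded.measure (\<lambda>(k, x, l). k - length l)") auto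

function hatB :: "nat \<Rightarrow> (bool list \<Rightarrow> real) \<Rightarrow> bool list \<Rightarrow> real" where
  "hatB k x l =
     (if length l < k then
        (if even (length l)
         then (hatB k x (l @ [False]) + hatB k x (l @ [True])) / 2
         else hatB k x (l @ [False]) + hatB k x (l @ [True]))
      else x l)"
  by auto
termination by (relation "Wellfounded.measure (\<lambda>(k, x, l). k - length l)") auto

declare hatA.simps [simp del] hatB.simps [simp del]

definition KtildeA :: "nat \<Rightarrow> (bool list \<Rightarrow> real) set" where
  "KtildeA k = {x \<in> bitstrings k \<rightarrow>\<^sub>E {0..1}. hatA k x [] = 1 \<and>
     (\<forall>l. odd (length l) \<and> length l < k \<longrightarrow> hatA k x (l @ [False]) = hatA k x (l @ [True]))}"

definition KtildeB :: "nat \<Rightarrow> (bool list \<Rightarrow> real) set" where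
  "KtildeB k = {x \<in> bitstrings k \<rightarrow>\<^sub>E {0..1}. hatB k x [] = 1 \<and>
     (\<forall>l. even (length l) \<and> length l < k \<longrightarrow> hatB k x (l @ [False]) = hatB k x (l @ [True]))}"

definition mask :: "nat \<Rightarrow> (bool list \<Rightarrow> real) \<Rightarrow> bool list \<Rightarrow> real" where
  "mask k x = (\<lambda>l\<in>bitstrings k. x l * of_bool (last l))"

definition KA :: "nat \<Rightarrow> (bool list \<Rightarrow> real) set" where
  "KA k = mask k ` KtildeA k"

definition KB :: "nat \<Rightarrow> (bool list \<Rightarrow> real) set" where
  "KB k = mask k ` KtildeB k"

definition dotp :: "nat \<Rightarrow> (bool list \<Rightarrow> real) \<Rightarrow> (bool list \<Rightarrow> real) \<Rightarrow> real" where
  "dotp k a b = (\<Sum>l\<in>bitstrings k. a l * b l)"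


section \<open>The two distributions\<close>

text \<open>
  Points of \<open>{0,1}\<^sup>n\<close> are functions on \<open>nat\<close> that are \<open>False\<close> off \<open>{..<n}\<close>, matching the
  default-value convention of \<^const>\<open>Pi_pmf\<close>.
\<close>

definition cube :: "nat \<Rightarrow> (nat \<Rightarrow> bool) set" where
  "cube n = PiE_dflt {..<n} False (\<lambda>_. UNIV)"

definition BN :: "nat \<Rightarrow> (bool \<times> bool) pmf" where
  "BN q = pair_pmf (bernoulli_pmf (1 / real q)) (pmf_of_set UNIV)"

definition BY_weight :: "nat \<Rightarrow> bool \<times> bool \<Rightarrow> real" where
  "BY_weight q = (\<lambda>(x, y).
     if \<not> x \<and> y then 1 / 2 * (1 - 1.95 / real q)
     else if \<not> x \<and> \<not> y then 1 / 2 * (1 - 0.05 / real q)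
     else if x \<and> y then 1.95 / (2 * real q)
     else 0.05 / (2 * real q))"

text \<open>For \<open>q = 1\<close> one of the weights is negative, and \<open>BY 1\<close> is an unspecified distribution.\<close>

definition BY :: "nat \<Rightarrow> (bool \<times> bool) pmf" where
  "BY q = embed_pmf (BY_weight q)"

lemma pmf_BY:
  assumes "q \<ge> 2"
  shows "pmf (BY q) z = BY_weight q z"
  unfolding BY_def
proof (rule pmf_embed_pmf)
  have q: "real q \<ge> 2" using assms by simp
  show nonneg: "0 \<le> BY_weight q x" for x
    using q by (auto simp: BY_weight_def field_simps split: prod.splits)
  have "(\<Sum>x\<in>UNIV. BY_weight q x) = 1"
    using q by (simp add: UNIV_Times_UNIV [symmetric] UNIV_bool sum.cartesian_product [symmetric]
        BY_weight_def field_simps del: UNIV_Times_UNIV)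
  then show "(\<integral>\<^sup>+x. ennreal (BY_weight q x) \<partial>count_space UNIV) = 1"
    by (simp add: nn_integral_count_space_finite sum_ennreal nonneg)
qed

definition power_pmf :: "nat \<Rightarrow> (bool \<times> bool) pmf \<Rightarrow> (nat \<Rightarrow> bool \<times> bool) pmf" where
  "power_pmf n B = Pi_pmf {..<n} (False, False) (\<lambda>_. B)"

definition success ::
  "nat \<Rightarrow> (nat \<Rightarrow> bool \<times> bool) pmf \<Rightarrow> (nat \<Rightarrow> bool \<times> bool) pmf \<Rightarrow>
   ((nat \<Rightarrow> bool) \<Rightarrow> bool list \<Rightarrow> real) \<Rightarrow> ((nat \<Rightarrow> bool) \<Rightarrow> bool list \<Rightarrow> real) \<Rightarrow> real" where
  "success k Y N f g =
     measure_pmf.expectation Y (\<lambda>w. dotp k (f (fst \<circ> w)) (g (snd \<circ> w))) -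
     measure_pmf.expectation N (\<lambda>w. dotp k (f (fst \<circ> w)) (g (snd \<circ> w)))"


section \<open>Low-degree influences\<close>

definition chi :: "real \<Rightarrow> bool \<Rightarrow> real" where
  "chi p z = (of_bool z - p) / sqrt (p * (1 - p))"

definition is_expansion ::
  "real \<Rightarrow> nat \<Rightarrow> ((nat \<Rightarrow> bool) \<Rightarrow> real) \<Rightarrow> (nat set \<Rightarrow> real) \<Rightarrow> bool" where
  "is_expansion p n h c \<longleftrightarrow>
     (\<forall>S. \<not> S \<subseteq> {..<n} \<longrightarrow> c S = 0) \<and>
     (\<forall>z\<in>cube n. h z = (\<Sum>S\<in>Pow {..<n}. c S * (\<Prod>i\<in>S. chi p (z i))))"

definition coeff_hat :: "real \<Rightarrow> nat \<Rightarrow> ((nat \<Rightarrow> bool) \<Rightarrow> real) \<Rightarrow> nat set \<Rightarrow> real" where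
  "coeff_hat p n h = (THE c. is_expansion p n h c)"

definition low_deg_influence ::
  "real \<Rightarrow> nat \<Rightarrow> nat \<Rightarrow> nat \<Rightarrow> ((nat \<Rightarrow> bool) \<Rightarrow> real) \<Rightarrow> real" where
  "low_deg_influence p n d i h =
     (\<Sum>S | S \<subseteq> {..<n} \<and> i \<in> S \<and> card S \<le> d. (coeff_hat p n h S)\<^sup>2)"

lemma cube_eq: "cube n = (\<lambda>X i. i \<in> X) ` Pow {..<n}"
proof (intro equalityI subsetI)
  fix z assume "z \<in> cube n"
  then have "z = (\<lambda>i. i \<in> {i. z i})" "{i. z i} \<in> Pow {..<n}"
    by (force simp: cube_def PiE_dflt_def)+
  then show "z \<in> (\<lambda>X i. i \<in> X) ` Pow {..<n}" by blast
qed (auto simp: cube_def PiE_dflt_def)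

lemma finite_cube: "finite (cube n)"
  by (simp add: cube_eq)

lemma sum_cube_prod:
  fixes F :: "nat \<Rightarrow> bool \<Rightarrow> real"
  shows "(\<Sum>w\<in>cube n. \<Prod>i<n. F i (w i)) = (\<Prod>i<n. F i True + F i False)"
proof -
  have "(\<Sum>w\<in>cube n. \<Prod>i<n. F i (w i)) = (\<Sum>X\<in>Pow {..<n}. \<Prod>i<n. F i (i \<in> X))"
    unfolding cube_eq by (subst sum.reindex) (auto simp: inj_on_def fun_eq_iff)
  also have "\<dots> = (\<Sum>X\<in>Pow {..<n}. (\<Prod>i\<in>X. F i True) * (\<Prod>i\<in>{..<n} - X. F i False))"
  proof (intro sum.cong refl)
    fix X assume X: "X \<in> Pow {..<n}"
    have "(\<Prod>i<n. F i (i \<in> X)) = (\<Prod>i\<in>{..<n} - X. F i (i \<in> X)) * (\<Prod>i\<in>X. F i (i \<in> X))"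
      using X by (intro prod.subset_diff) auto
    moreover have "(\<Prod>i\<in>{..<n} - X. F i (i \<in> X)) = (\<Prod>i\<in>{..<n} - X. F i False)"
      by (intro prod.cong) auto
    ultimately show "(\<Prod>i<n. F i (i \<in> X)) = (\<Prod>i\<in>X. F i True) * (\<Prod>i\<in>{..<n} - X. F i False)"
      by (simp add: mult.commute)
  qed
  also have "\<dots> = (\<Prod>i<n. F i True + F i False)"
    by (subst prod_add) auto
  finally show ?thesis .
qed

definition bern_weight :: "real \<Rightarrow> nat \<Rightarrow> (nat \<Rightarrow> bool) \<Rightarrow> real" where
  "bern_weight p n w = (\<Prod>i<n. if w i then p else 1 - p)"

lemma chi_prod_extend:
  fixes n :: nat
  assumes "S \<subseteq> {..<n}"
  shows "(\<Prod>i\<in>S. chi p (z i)) = (\<Prod>i<n. if i \<in> S then chi p (z i) else 1)"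
proof -
  have "(\<Prod>i\<in>{..<n} \<inter> S. chi p (z i)) = (\<Prod>i<n. if i \<in> S then chi p (z i) else 1)"
    by (rule prod.inter_restrict) simp
  with assms show ?thesis by (simp add: Int_absorb1)
qed

lemma chi_orthonormal:
  assumes p: "0 < p" "p < 1" and S: "S \<subseteq> {..<n}" and T: "T \<subseteq> {..<n}"
  shows "(\<Sum>w\<in>cube n. bern_weight p n w * (\<Prod>i\<in>S. chi p (w i)) * (\<Prod>i\<in>T. chi p (w i)))
           = of_bool (S = T)"
proof -
  define F where "F i b = (if b then p else 1 - p) * (if i \<in> S then chi p b else 1) *
    (if i \<in> T then chi p b else 1)" for i b
  have "(\<Sum>w\<in>cube n. bern_weight p n w * (\<Prod>i\<in>S. chi p (w i)) * (\<Prod>i\<in>T. chi p (w i)))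
      = (\<Sum>w\<in>cube n. \<Prod>i<n. F i (w i))"
    by (simp add: bern_weight_def chi_prod_extend [OF S] chi_prod_extend [OF T] F_def prod.distrib)
  also have "\<dots> = (\<Prod>i<n. F i True + F i False)" by (rule sum_cube_prod)
  also have "\<dots> = (\<Prod>i<n. of_bool (i \<in> S \<longleftrightarrow> i \<in> T))"
  proof (intro prod.cong refl)
    fix i
    have s: "sqrt (p * (1 - p)) * sqrt (p * (1 - p)) = p * (1 - p)" "p * (1 - p) \<noteq> 0"
      using p by auto
    have "p * (chi p True * chi p True) + (1 - p) * (chi p False * chi p False) = 1"
      using p s by (simp add: chi_def)
    moreover have "p * chi p True + (1 - p) * chi p False = 0"
      using p by (simp add: chi_def divide_simps)
    ultimately show "F i True + F i False = of_bool (i \<in> S \<longleftrightarrow> i \<in> T)"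
      by (auto simp: F_def mult.assoc)
  qed
  also have "\<dots> = of_bool (S = T)"
    using S T by (auto simp: of_bool_def prod_zero_iff)
  finally show ?thesis .
qed

lemma chi_dual:
  assumes p: "0 < p" "p < 1" and w: "w \<in> cube n" and z: "z \<in> cube n"
  shows "bern_weight p n w * (\<Sum>S\<in>Pow {..<n}. (\<Prod>i\<in>S. chi p (w i)) * (\<Prod>i\<in>S. chi p (z i)))
           = of_bool (w = z)"
proof -
  have "(\<Sum>S\<in>Pow {..<n}. (\<Prod>i\<in>S. chi p (w i)) * (\<Prod>i\<in>S. chi p (z i)))
      = (\<Prod>i<n. chi p (w i) * chi p (z i) + 1)"
    by (subst prod_add) (auto simp: prod.distrib)
  then have "bern_weight p n w * (\<Sum>S\<in>Pow {..<n}. (\<Prod>i\<in>S. chi p (w i)) * (\<Prod>i\<in>S. chi p (z i)))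
      = (\<Prod>i<n. (if w i then p else 1 - p) * (chi p (w i) * chi p (z i) + 1))"
    by (simp add: bern_weight_def prod.distrib)
  also have "\<dots> = (\<Prod>i<n. of_bool (w i \<longleftrightarrow> z i))"
  proof (intro prod.cong refl)
    fix i
    have s: "sqrt (p * (1 - p)) * sqrt (p * (1 - p)) = p * (1 - p)" "p * (1 - p) \<noteq> 0"
      using p by auto
    show "(if w i then p else 1 - p) * (chi p (w i) * chi p (z i) + 1) = of_bool (w i \<longleftrightarrow> z i)"
      using p s by (cases "w i"; cases "z i"; simp add: chi_def; simp add: field_simps)
  qed
  also have "\<dots> = of_bool (w = z)"
  proof (cases "w = z")
    case False
    then obtain i where "w i \<noteq> z i" by auto
    moreover from this have "i < n"
      using w z by (auto simp: cube_def PiE_dflt_def)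
    ultimately show ?thesis using False by (auto intro!: prod_zero)
  qed simp
  finally show ?thesis .
qed

lemma expansion_unique:
  assumes p: "0 < p" "p < 1" and c: "is_expansion p n h c" and S: "S \<subseteq> {..<n}"
  shows "c S = (\<Sum>w\<in>cube n. bern_weight p n w * h w * (\<Prod>i\<in>S. chi p (w i)))"
proof -
  have "(\<Sum>w\<in>cube n. bern_weight p n w * h w * (\<Prod>i\<in>S. chi p (w i)))
      = (\<Sum>w\<in>cube n. \<Sum>T\<in>Pow {..<n}. c T *
          (bern_weight p n w * (\<Prod>i\<in>T. chi p (w i)) * (\<Prod>i\<in>S. chi p (w i))))"
  proof (intro sum.cong refl)
    fix w assume "w \<in> cube n"
    then have "h w = (\<Sum>T\<in>Pow {..<n}. c T * (\<Prod>i\<in>T. chi p (w i)))"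
      using c by (simp add: is_expansion_def)
    then show "bern_weight p n w * h w * (\<Prod>i\<in>S. chi p (w i)) = (\<Sum>T\<in>Pow {..<n}. c T *
        (bern_weight p n w * (\<Prod>i\<in>T. chi p (w i)) * (\<Prod>i\<in>S. chi p (w i))))"
      by (simp add: sum_distrib_left sum_distrib_right mult_ac)
  qed
  also have "\<dots> = (\<Sum>T\<in>Pow {..<n}. c T * of_bool (T = S))"
    by (subst sum.swap, simp only: sum_distrib_left [symmetric])
       (intro sum.cong refl, simp only: Pow_iff chi_orthonormal [OF p _ S])
  also have "\<dots> = c S"
    using S by (simp add: of_bool_def if_distrib [of "\<lambda>x. _ * x"] cong: if_cong)
  finally show ?thesis ..
qed

lemma expansion_exists:
  assumes p: "0 < p" "p < 1"
  shows "is_expansion p n h (\<lambda>S. if S \<subseteq> {..<n}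
           then \<Sum>w\<in>cube n. bern_weight p n w * h w * (\<Prod>i\<in>S. chi p (w i)) else 0)"
  unfolding is_expansion_def
proof (intro conjI ballI allI impI)
  fix z assume z: "z \<in> cube n"
  have "(\<Sum>S\<in>Pow {..<n}. (if S \<subseteq> {..<n}
           then \<Sum>w\<in>cube n. bern_weight p n w * h w * (\<Prod>i\<in>S. chi p (w i)) else 0) *
           (\<Prod>i\<in>S. chi p (z i)))
      = (\<Sum>S\<in>Pow {..<n}. \<Sum>w\<in>cube n. h w * (bern_weight p n w *
           ((\<Prod>i\<in>S. chi p (w i)) * (\<Prod>i\<in>S. chi p (z i)))))"
    by (intro sum.cong refl) (simp add: sum_distrib_left sum_distrib_right mult_ac)
  also have "\<dots> = (\<Sum>w\<in>cube n. h w * of_bool (w = z))"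
    by (subst sum.swap, simp only: sum_distrib_left [symmetric])
       (intro sum.cong refl, simp only: chi_dual [OF p _ z])
  also have "\<dots> = h z"
    using z by (simp add: of_bool_def if_distrib [of "\<lambda>x. _ * x"] finite_cube cong: if_cong)
  finally show "h z = (\<Sum>S\<in>Pow {..<n}. (if S \<subseteq> {..<n}
           then \<Sum>w\<in>cube n. bern_weight p n w * h w * (\<Prod>i\<in>S. chi p (w i)) else 0) *
           (\<Prod>i\<in>S. chi p (z i)))" ..
qed auto

text \<open>The description operator in \<^const>\<open>coeff_hat\<close> is justified for every \<open>0 < p < 1\<close>.\<close>

lemma is_expansion_ex1:
  assumes p: "0 < p" "p < 1"
  shows "\<exists>!c. is_expansion p n h c"
proof (rule ex_ex1I)
  show "\<exists>c. is_expansion p n h c" using expansion_exists [OF p] by blast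
  fix c c' assume c: "is_expansion p n h c" "is_expansion p n h c'"
  show "c = c'"
  proof
    fix S show "c S = c' S"
      using expansion_unique [OF p c(1)] expansion_unique [OF p c(2)] c
      by (cases "S \<subseteq> {..<n}") (auto simp: is_expansion_def)
  qed
qed

lemma is_expansion_coeff_hat:
  "0 < p \<Longrightarrow> p < 1 \<Longrightarrow> is_expansion p n h (coeff_hat p n h)"
  unfolding coeff_hat_def by (rule theI' [OF is_expansion_ex1])

end

theory Submission
  imports Defs
begin

text \<open>
  The bases \<open>\<chi>\<^sub>S(x)\<close> (bias \<open>1/q\<close>) and \<open>\<chi>\<^sub>S(y)\<close> (bias \<open>1/2\<close>) diagonalise both distributions:
  the correlation of \<open>\<chi>\<^sub>S(x)\<close> with \<open>\<chi>\<^sub>S(y)\<close> is \<open>\<rho>\<close> to the power \<open>|S|\<close>, with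
  \<open>\<rho> = 0.95 / sqrt (q - 1)\<close> for the first and \<open>\<rho> = 0\<close> for the second.
  Fix \<open>s = 1 / (1 + \<rho>)\<close>. If two functions with values in \<open>[0,1]\<close> have no common influential
  coordinate, they satisfy the two-function hypercontractive inequality
  \<open>E[f g] \<le> (E f * E g) powr s\<close> of the Gaussian space up to a small error. To see this, average out
  the few coordinates influential for one of them, apply a little noise, and follow
  \<open>(F\<^sub>m + \<delta>) powr s * (G\<^sub>m + \<delta>) powr s\<close> along the coordinate-exposing martingales \<open>F\<^sub>m\<close>, \<open>G\<^sub>m\<close>.
  Each step does not increase its expectation, except for an error cubic in the increments; by
  hypercontractivity for low-degree polynomials the cubic errors sum to little when all influences
  are small.

  Applying this to each of the \<open>2^k\<close> coordinates, with \<open>t\<^sub>j = E f\<^sub>j * E g\<^sub>j\<close> and \<open>\<Sum>j. t\<^sub>j \<le> 1\<close>,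
  the success is at most about \<open>\<Sum>j. t\<^sub>j powr s - t\<^sub>j\<close>, which by concavity is \<open>O(k \<rho>) = O(k / sqrt q)\<close>.
\<close>

subsection \<open>Expectations over product distributions\<close>

abbreviation expect :: "(bool \<times> bool) pmf \<Rightarrow> nat \<Rightarrow> ((nat \<Rightarrow> bool \<times> bool) \<Rightarrow> real) \<Rightarrow> real" where
  "expect B n \<Phi> \<equiv> measure_pmf.expectation (power_pmf n B) \<Phi>"

lemma integrable_finite_type [simp]: "integrable (measure_pmf (B :: 'a::finite pmf)) (h :: _ \<Rightarrow> real)"
  by (rule integrable_measure_pmf_finite) simp

lemma finite_set_power_pmf: "finite (set_pmf (power_pmf n B))"
proof (rule finite_subset)
  show "set_pmf (power_pmf n B) \<subseteq> PiE_dflt {..<n} (False, False) (\<lambda>_. UNIV)"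
    unfolding power_pmf_def by (rule order_trans [OF set_Pi_pmf_subset']) (auto simp: PiE_dflt_def)
qed (rule finite_PiE_dflt, auto)

lemma integrable_power_pmf [simp]: "integrable (measure_pmf (power_pmf n B)) (h :: _ \<Rightarrow> real)"
  by (rule integrable_measure_pmf_finite [OF finite_set_power_pmf])

lemma expect_mono: "(\<And>w. F w \<le> G w) \<Longrightarrow> expect B n F \<le> expect B n G"
  by (rule integral_mono) auto

lemma expect_Suc:
  "expect B (Suc n) \<Phi> = expect B n (\<lambda>w. measure_pmf.expectation B (\<lambda>a. \<Phi> (w(n := a))))"
proof -
  have "power_pmf (Suc n) B = map_pmf (\<lambda>(a, w). w(n := a)) (pair_pmf B (power_pmf n B))"
    unfolding power_pmf_def lessThan_Suc by (rule Pi_pmf_insert) auto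
  also have "\<dots> = bind_pmf (power_pmf n B) (\<lambda>w. map_pmf (\<lambda>a. w(n := a)) B)"
    unfolding pair_pmf_def by (subst bind_commute_pmf) (simp add: map_bind_pmf map_pmf_def bind_assoc_pmf bind_return_pmf)
  finally have eq: "power_pmf (Suc n) B = bind_pmf (power_pmf n B) (\<lambda>w. map_pmf (\<lambda>a. w(n := a)) B)" .
  show ?thesis
    unfolding eq
    by (subst pmf_expectation_bind [OF finite_set_power_pmf])
       (auto simp: integral_measure_pmf [OF finite_set_power_pmf])
qed

lemma expect_0: "expect B 0 \<Phi> = \<Phi> (\<lambda>_. (False, False))"
  by (simp add: power_pmf_def)

lemma expect_square_product:
  assumes FG: "expect B n (\<lambda>w. (F w)^4) \<le> a\<^sup>2" "expect B n (\<lambda>w. (G w)^4) \<le> b\<^sup>2"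
    and ab: "0 \<le> a" "0 \<le> b"
  shows "expect B n (\<lambda>w. (F w)\<^sup>2 * (G w)\<^sup>2) \<le> a * b"
proof -
  have key: "expect B n (\<lambda>w. (F w)\<^sup>2 * (G w)\<^sup>2) \<le> (a + e) * (b + e)" if e: "e > 0" for e
  proof -
    define t where "t = (b + e) / (a + e)"
    have t: "t > 0" using e ab by (simp add: t_def add_nonneg_pos)
    have pt: "(F w)\<^sup>2 * (G w)\<^sup>2 \<le> t / 2 * (F w)^4 + 1 / (2 * t) * (G w)^4" for w
    proof -
      have "0 \<le> (t * (F w)\<^sup>2 - (G w)\<^sup>2)\<^sup>2 / (2 * t)" using t by simp
      also have "\<dots> = t / 2 * (F w)^4 + 1 / (2 * t) * (G w)^4 - (F w)\<^sup>2 * (G w)\<^sup>2"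
        using t by (simp add: power4_eq_xxxx power2_eq_square field_simps)
      finally show ?thesis by simp
    qed
    have "expect B n (\<lambda>w. (F w)\<^sup>2 * (G w)\<^sup>2) \<le> expect B n (\<lambda>w. t / 2 * (F w)^4 + 1 / (2 * t) * (G w)^4)"
      by (intro expect_mono pt)
    also have "\<dots> = t / 2 * expect B n (\<lambda>w. (F w)^4) + 1 / (2 * t) * expect B n (\<lambda>w. (G w)^4)"
      by (subst Bochner_Integration.integral_add) simp_all
    also have "\<dots> \<le> t / 2 * (a + e)\<^sup>2 + 1 / (2 * t) * (b + e)\<^sup>2"
    proof (intro add_mono mult_left_mono)
      have "a\<^sup>2 \<le> (a + e)\<^sup>2" "b\<^sup>2 \<le> (b + e)\<^sup>2" using e ab by (auto intro: power_mono)
      then show "expect B n (\<lambda>w. (F w)^4) \<le> (a + e)\<^sup>2" "expect B n (\<lambda>w. (G w)^4) \<le> (b + e)\<^sup>2"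
        using FG by linarith+
    qed (use t in auto)
    also have "\<dots> = (a + e) * (b + e)"
    proof -
      have "B / A / 2 * A\<^sup>2 + 1 / (2 * (B / A)) * B\<^sup>2 = A * B" if "A > 0" "B > 0" for A B :: real
        using that by (simp add: power2_eq_square field_simps)
      moreover have "0 < a + e" "0 < b + e" using e ab by auto
      ultimately show ?thesis unfolding t_def by blast
    qed
    finally show ?thesis .
  qed
  have lim: "((\<lambda>e. (a + e) * (b + e)) \<longlongrightarrow> (a + 0) * (b + 0)) (at_right 0)"
    by (intro tendsto_intros)
  have "expect B n (\<lambda>w. (F w)\<^sup>2 * (G w)\<^sup>2) \<le> (a + 0) * (b + 0)"
    by (rule tendsto_lowerbound [OF lim]) (use key in \<open>auto simp: eventually_at_filter\<close>)
  then show ?thesis by simp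
qed

lemma sum_Pow_Suc:
  fixes h :: "nat set \<Rightarrow> real"
  shows "sum h (Pow {..<Suc n}) = sum h (Pow {..<n}) + (\<Sum>S\<in>Pow {..<n}. h (insert n S))"
proof -
  have "inj_on (insert n) (Pow {..<n})" by (auto simp: inj_on_def)
  then show ?thesis
    unfolding lessThan_Suc Pow_insert
    by (subst sum.union_disjoint) (auto simp: sum.reindex)
qed


subsection \<open>Multilinear polynomials in a standardised random variable\<close>

definition multilin ::
  "(bool \<times> bool \<Rightarrow> real) \<Rightarrow> nat \<Rightarrow> (nat set \<Rightarrow> real) \<Rightarrow> (nat \<Rightarrow> bool \<times> bool) \<Rightarrow> real" where
  "multilin \<phi> n c w = (\<Sum>S\<in>Pow {..<n}. c S * (\<Prod>i\<in>S. \<phi> (w i)))"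

lemma multilin_0 [simp]: "multilin \<phi> 0 c w = c {}"
  by (simp add: multilin_def)

lemma multilin_upd [simp]: "multilin \<phi> n c (w(n := a)) = multilin \<phi> n c w"
proof -
  have "(\<Prod>i\<in>S. \<phi> ((w(n := a)) i)) = (\<Prod>i\<in>S. \<phi> (w i))" if "S \<in> Pow {..<n}" for S
    using that by (intro prod.cong) auto
  then show ?thesis by (simp add: multilin_def)
qed

lemma multilin_Suc:
  "multilin \<phi> (Suc n) c w = multilin \<phi> n c w + \<phi> (w n) * multilin \<phi> n (\<lambda>S. c (insert n S)) w"
proof -
  have "(\<Prod>i\<in>insert n S. \<phi> (w i)) = \<phi> (w n) * (\<Prod>i\<in>S. \<phi> (w i))" if "S \<in> Pow {..<n}" for S
    using that by (subst prod.insert) (auto intro: finite_subset)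
  then show ?thesis
    by (simp add: multilin_def sum_Pow_Suc sum_distrib_left mult_ac)
qed

lemma multilin_add: "multilin \<phi> n (\<lambda>S. c S + e S) w = multilin \<phi> n c w + multilin \<phi> n e w"
  by (simp add: multilin_def distrib_right sum.distrib)

lemma card_insert_Pow: "S \<in> Pow {..<n} \<Longrightarrow> card (insert n S) = Suc (card S)" for n :: nat
  by (subst card_insert_disjoint) (auto intro: finite_subset)

locale standardised =
  fixes B :: "(bool \<times> bool) pmf" and \<phi> :: "bool \<times> bool \<Rightarrow> real"
  assumes mean: "measure_pmf.expectation B \<phi> = 0"
    and var: "measure_pmf.expectation B (\<lambda>a. (\<phi> a)\<^sup>2) = 1"
begin

lemma expectation_affine_square:
  "measure_pmf.expectation B (\<lambda>a. (x + \<phi> a * y)\<^sup>2) = x\<^sup>2 + y\<^sup>2"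
proof -
  have "(\<lambda>a. (x + \<phi> a * y)\<^sup>2) = (\<lambda>a. x\<^sup>2 + ((2 * x * y) * \<phi> a + y\<^sup>2 * (\<phi> a)\<^sup>2))"
    by (auto simp: power2_eq_square algebra_simps)
  then show ?thesis using mean var by simp
qed

lemma parseval: "expect B n (\<lambda>w. (multilin \<phi> n c w)\<^sup>2) = (\<Sum>S\<in>Pow {..<n}. (c S)\<^sup>2)"
proof (induction n arbitrary: c)
  case (Suc n)
  show ?case
    by (simp add: expect_Suc multilin_Suc expectation_affine_square Suc sum_Pow_Suc)
qed (simp add: expect_0)

lemma expectation_affine_fourth:
  assumes M: "\<And>a. \<bar>\<phi> a\<bar> \<le> M"
  shows "measure_pmf.expectation B (\<lambda>a. (x + \<phi> a * y)^4) \<le> x^4 + 8 * (x\<^sup>2 * y\<^sup>2) + 3 * M\<^sup>2 * y^4"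
proof -
  have "(x + \<phi> a * y)^4 \<le> (x^4 + (4 * x^3 * y) * \<phi> a) + (8 * (x\<^sup>2 * y\<^sup>2) + 3 * M\<^sup>2 * y^4) * (\<phi> a)\<^sup>2" for a
  proof -
    have "(x + \<phi> a * y)^4 = x^4 + 4 * x^3 * y * \<phi> a + 6 * x\<^sup>2 * y\<^sup>2 * (\<phi> a)\<^sup>2 + 4 * x * y^3 * (\<phi> a)^3 + y^4 * (\<phi> a)^4"
      by (simp add: power4_eq_xxxx power3_eq_cube power2_eq_square algebra_simps)
    moreover have "4 * x * y^3 * (\<phi> a)^3 \<le> 2 * x\<^sup>2 * y\<^sup>2 * (\<phi> a)\<^sup>2 + 2 * y^4 * (\<phi> a)^4"
    proof -
      have "0 \<le> 2 * (x * y * \<phi> a - y\<^sup>2 * (\<phi> a)\<^sup>2)\<^sup>2" by simp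
      also have "\<dots> = 2 * x\<^sup>2 * y\<^sup>2 * (\<phi> a)\<^sup>2 + 2 * y^4 * (\<phi> a)^4 - 4 * x * y^3 * (\<phi> a)^3"
        by (simp add: power4_eq_xxxx power3_eq_cube power2_eq_square algebra_simps)
      finally show ?thesis by simp
    qed
    moreover have "3 * y^4 * (\<phi> a)^4 \<le> 3 * M\<^sup>2 * y^4 * (\<phi> a)\<^sup>2"
    proof -
      have "(\<phi> a)\<^sup>2 \<le> M\<^sup>2" using M by (metis abs_ge_zero order_trans power2_abs power_mono)
      then have "(3 * y^4 * (\<phi> a)\<^sup>2) * (\<phi> a)\<^sup>2 \<le> (3 * y^4 * (\<phi> a)\<^sup>2) * M\<^sup>2"
        by (intro mult_left_mono) auto
      then show ?thesis by (simp add: power4_eq_xxxx power2_eq_square mult_ac)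
    qed
    ultimately show ?thesis by (simp add: algebra_simps)
  qed
  then have "measure_pmf.expectation B (\<lambda>a. (x + \<phi> a * y)^4) \<le>
      measure_pmf.expectation B (\<lambda>a. (x^4 + (4 * x^3 * y) * \<phi> a) + (8 * (x\<^sup>2 * y\<^sup>2) + 3 * M\<^sup>2 * y^4) * (\<phi> a)\<^sup>2)"
    by (intro integral_mono) auto
  also have "\<dots> = x^4 + 8 * (x\<^sup>2 * y\<^sup>2) + 3 * M\<^sup>2 * y^4"
    using mean var by simp
  finally show ?thesis .
qed

lemma hypercontractive:
  assumes M: "\<And>a. \<bar>\<phi> a\<bar> \<le> M" and r: "8 * r\<^sup>2 \<le> 2" "3 * M\<^sup>2 * r^4 \<le> 1"
  shows "expect B n (\<lambda>w. (multilin \<phi> n (\<lambda>S. r ^ card S * c S) w)^4) \<le> (\<Sum>S\<in>Pow {..<n}. (c S)\<^sup>2)\<^sup>2"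
proof (induction n arbitrary: c)
  case 0
  show ?case by (simp add: expect_0 power4_eq_xxxx power2_eq_square)
next
  case (Suc n)
  define F where "F = multilin \<phi> n (\<lambda>S. r ^ card S * c S)"
  define G where "G = multilin \<phi> n (\<lambda>S. r ^ card S * c (insert n S))"
  define a where "a = (\<Sum>S\<in>Pow {..<n}. (c S)\<^sup>2)"
  define b where "b = (\<Sum>S\<in>Pow {..<n}. (c (insert n S))\<^sup>2)"
  have ab: "0 \<le> a" "0 \<le> b" by (auto simp: a_def b_def intro: sum_nonneg)
  have IH: "expect B n (\<lambda>w. (F w)^4) \<le> a\<^sup>2" "expect B n (\<lambda>w. (G w)^4) \<le> b\<^sup>2"
    unfolding F_def G_def a_def b_def by (rule Suc)+
  have Gr: "multilin \<phi> n (\<lambda>S. r ^ card (insert n S) * c (insert n S)) w = r * G w" for w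
    by (simp add: multilin_def G_def card_insert_Pow sum_distrib_left mult_ac)
  have "expect B (Suc n) (\<lambda>w. (multilin \<phi> (Suc n) (\<lambda>S. r ^ card S * c S) w)^4) =
      expect B n (\<lambda>w. measure_pmf.expectation B (\<lambda>a. (F w + \<phi> a * (r * G w))^4))"
    by (simp add: expect_Suc multilin_Suc Gr F_def G_def)
  also have "\<dots> \<le> expect B n (\<lambda>w. (F w)^4 + (8 * r\<^sup>2) * ((F w)\<^sup>2 * (G w)\<^sup>2) + (3 * M\<^sup>2 * r^4) * (G w)^4)"
    by (intro expect_mono order_trans [OF expectation_affine_fourth [OF M]]) (simp add: power_mult_distrib algebra_simps)
  also have "\<dots> \<le> expect B n (\<lambda>w. (F w)^4 + 2 * ((F w)\<^sup>2 * (G w)\<^sup>2) + (G w)^4)"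
  proof (intro expect_mono add_mono order_refl)
    show "(8 * r\<^sup>2) * ((F w)\<^sup>2 * (G w)\<^sup>2) \<le> 2 * ((F w)\<^sup>2 * (G w)\<^sup>2)" for w
      using r by (intro mult_right_mono) auto
    show "(3 * M\<^sup>2 * r^4) * (G w)^4 \<le> (G w)^4" for w
      using mult_right_mono [OF r(2), of "(G w)^4"] by simp
  qed
  also have "\<dots> = expect B n (\<lambda>w. (F w)^4) + 2 * expect B n (\<lambda>w. (F w)\<^sup>2 * (G w)\<^sup>2) + expect B n (\<lambda>w. (G w)^4)"
    by simp
  also have "\<dots> \<le> a\<^sup>2 + 2 * (a * b) + b\<^sup>2"
    using IH expect_square_product [OF IH ab] by simp
  also have "\<dots> = (a + b)\<^sup>2" by (simp add: power2_eq_square algebra_simps)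
  finally show ?case by (simp add: sum_Pow_Suc a_def b_def)
qed

end


subsection \<open>A cubic Taylor bound for products of powers\<close>

lemma powr_taylor_upper:
  fixes x s :: real
  assumes x: "-1 < x" and s: "0 \<le> s" "s \<le> 1"
  shows "(1 + x) powr s \<le> 1 + s * x - s * (1 - s) / 2 * x\<^sup>2 + \<bar>x\<bar>^3"
proof (cases "x = 0")
  case False
  define D where "D m t = (\<Prod>i<m. s - real i) * (1 + t) powr (s - real m)" for m t
  have "\<exists>t. (if x < 0 then x < t \<and> t < 0 else 0 < t \<and> t < x) \<and>
      D 0 x = (\<Sum>m<3. (D m 0 / fact m) * (x - 0)^m) + (D 3 t / fact 3) * (x - 0)^3"
  proof (rule Taylor [where a = "min x 0" and b = "max x 0"])
    show "\<forall>m t. m < 3 \<and> min x 0 \<le> t \<and> t \<le> max x 0 \<longrightarrow> DERIV (D m) t :> D (Suc m) t"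
    proof (intro allI impI)
      fix m :: nat and t assume "m < 3 \<and> min x 0 \<le> t \<and> t \<le> max x 0"
      then have "1 + t > 0" using x by auto
      then show "DERIV (D m) t :> D (Suc m) t"
        unfolding D_def by (auto intro!: derivative_eq_intros simp: algebra_simps)
    qed
  qed (use False in auto)
  then obtain t where t: "if x < 0 then x < t \<and> t < 0 else 0 < t \<and> t < x"
    and eq: "D 0 x = (\<Sum>m<3. (D m 0 / fact m) * x^m) + (D 3 t / fact 3) * x^3" by auto
  define c where "c = s * (1 - s) * (2 - s)"
  have c: "0 \<le> c" "c \<le> 2"
  proof -
    have "s * (1 - s) \<le> 1 * 1" using s by (intro mult_mono) auto
    then have "c \<le> 1 * 2" unfolding c_def using s by (intro mult_mono) auto
    then show "c \<le> 2" by simp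
  qed (use s in \<open>simp add: c_def\<close>)
  have "(1 + x) powr s = 1 + s * x - s * (1 - s) / 2 * x\<^sup>2 + c * (1 + t) powr (s - 3) / 6 * x^3"
    using eq x by (simp add: D_def c_def eval_nat_numeral lessThan_Suc field_simps)
  moreover have "c * (1 + t) powr (s - 3) / 6 * x^3 \<le> \<bar>x\<bar>^3"
  proof (cases "x < 0")
    case True
    then have "x^3 \<le> 0" by (simp add: power_less_zero_eq less_imp_le)
    then have "c * (1 + t) powr (s - 3) / 6 * x^3 \<le> 0" using c by (intro mult_nonneg_nonpos) auto
    then show ?thesis by (smt (verit) zero_le_power abs_ge_zero)
  next
    case False
    then have "(1 + t) powr (s - 3) \<le> (1 + t) powr 0" using t s by (intro powr_mono) auto
    then have "c * (1 + t) powr (s - 3) \<le> 2 * 1" using c t False by (intro mult_mono) auto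
    then have "c * (1 + t) powr (s - 3) / 6 * x^3 \<le> 1 * x^3" using False by (intro mult_right_mono) auto
    then show ?thesis using False by simp
  qed
  ultimately show ?thesis by linarith
qed simp

lemma mult_cubic_bounds:
  fixes X Y K :: real
  assumes X: "0 \<le> X" "X \<le> K" and Y: "0 \<le> Y" "Y \<le> K" and K: "1 \<le> K"
  shows "X^3 + Y^3 + X * Y\<^sup>2 + X * Y^3 + X\<^sup>2 * Y + X\<^sup>2 * Y\<^sup>2 + X^3 * Y + X^3 * Y^3
    \<le> 10 * K^3 * (X^3 + Y^3)"
proof -
  define T where "T = X^3 + Y^3"
  have T0: "0 \<le> X^3" "0 \<le> Y^3" "0 \<le> T" using X Y by (auto simp: T_def)
  have K3: "1 \<le> K^3" "K \<le> K^3"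
    using K power_increasing [of 1 3 K] by auto
  have a: "X * Y\<^sup>2 \<le> T"
  proof (cases "X \<le> Y")
    case True
    then have "X * Y\<^sup>2 \<le> Y * Y\<^sup>2" by (intro mult_right_mono) auto
    then show ?thesis using T0 by (simp add: T_def power2_eq_square power3_eq_cube)
  next
    case False
    then have "X * Y\<^sup>2 \<le> X * X\<^sup>2" using X Y by (intro mult_left_mono power_mono) auto
    then show ?thesis using T0 by (simp add: T_def power2_eq_square power3_eq_cube)
  qed
  have b: "X\<^sup>2 * Y \<le> T"
  proof (cases "X \<le> Y")
    case True
    then have "X\<^sup>2 * Y \<le> Y\<^sup>2 * Y" using X Y by (intro mult_right_mono power_mono) auto
    then show ?thesis using T0 by (simp add: T_def power2_eq_square power3_eq_cube)
  next
    case False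
    then have "X\<^sup>2 * Y \<le> X\<^sup>2 * X" using X Y by (intro mult_left_mono) auto
    then show ?thesis using T0 by (simp add: T_def power2_eq_square power3_eq_cube)
  qed
  have d: "X * Y^3 \<le> K * Y^3" "X^3 * Y \<le> X^3 * K" "X^3 * Y^3 \<le> K^3 * Y^3"
    using X Y K by (auto intro!: mult_mono power_mono)
  have "X\<^sup>2 * Y\<^sup>2 = X * (X * Y\<^sup>2)" by (simp add: power2_eq_square)
  also have "\<dots> \<le> K * T" using X Y a T0 by (intro mult_mono) auto
  finally have e: "X\<^sup>2 * Y\<^sup>2 \<le> K * T" .
  have f: "K * T \<le> K^3 * T" "T \<le> K^3 * T" "K * Y^3 \<le> K * T" "X^3 * K \<le> K * T" "K^3 * Y^3 \<le> K^3 * T"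
    using K3 T0 K mult_right_mono [OF K3(1) T0(3)]
    by (auto intro: mult_right_mono mult_left_mono simp: T_def mult_ac)
  show ?thesis using a b d e f T0 unfolding T_def [symmetric] by (simp add: T_def [symmetric])
qed

lemma powr_product_upper:
  fixes x y s K :: real
  assumes x: "-1 < x" "\<bar>x\<bar> \<le> K" and y: "-1 < y" "\<bar>y\<bar> \<le> K" and K: "1 \<le> K" and s: "0 \<le> s" "s \<le> 1"
  shows "(1 + x) powr s * (1 + y) powr s \<le>
    1 + s * x + s * y - s * (1 - s) / 2 * (x\<^sup>2 + y\<^sup>2) + s\<^sup>2 * (x * y) + 10 * K^3 * (\<bar>x\<bar>^3 + \<bar>y\<bar>^3)"
proof -
  define r where "r = s * (1 - s) / 2"
  have "s * (1 - s) \<le> 1 * 1" using s by (intro mult_mono) auto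
  then have r: "0 \<le> r" "r \<le> 1" using s by (auto simp: r_def)
  define X Y where "X = \<bar>x\<bar>" and "Y = \<bar>y\<bar>"
  have XY: "0 \<le> X" "0 \<le> Y" "x\<^sup>2 = X\<^sup>2" "y\<^sup>2 = Y\<^sup>2" by (auto simp: X_def Y_def)
  have P: "(1 + x) powr s \<le> 1 + s * x - r * X\<^sup>2 + X^3" "(1 + y) powr s \<le> 1 + s * y - r * Y\<^sup>2 + Y^3"
    using powr_taylor_upper [OF x(1) s] powr_taylor_upper [OF y(1) s] by (auto simp: r_def X_def Y_def)
  have bnd: "u * v \<le> W" if "\<bar>u\<bar> \<le> 1" "\<bar>v\<bar> \<le> W" for u v W :: real
  proof -
    have "u * v \<le> \<bar>u\<bar> * \<bar>v\<bar>" by (metis abs_ge_self abs_mult)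
    also have "\<dots> \<le> 1 * W" using that by (intro mult_mono) auto
    finally show ?thesis by simp
  qed
  have sr: "s * r \<le> 1 * 1" "r * r \<le> 1 * 1" using s r by (intro mult_mono; auto)+
  have e1: "(- (s * r)) * (x * Y\<^sup>2) \<le> X * Y\<^sup>2"
    using s r sr by (intro bnd) (auto simp: abs_mult X_def)
  have e2: "s * (x * Y^3) \<le> X * Y^3"
    using s XY by (intro bnd) (auto simp: abs_mult X_def)
  have e3: "(- (s * r)) * (X\<^sup>2 * y) \<le> X\<^sup>2 * Y"
    using s r sr by (intro bnd) (auto simp: abs_mult Y_def)
  have e4: "(r * r) * (X\<^sup>2 * Y\<^sup>2) \<le> X\<^sup>2 * Y\<^sup>2"
    using s r sr by (intro bnd) (auto simp: abs_mult Y_def)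
  have e5: "s * (X^3 * y) \<le> X^3 * Y"
    using s XY by (intro bnd) (auto simp: abs_mult Y_def)
  have e6: "0 \<le> r * (X\<^sup>2 * Y^3)" "0 \<le> r * (X^3 * Y\<^sup>2)" using r XY by auto
  have "(1 + x) powr s * (1 + y) powr s \<le> (1 + s * x - r * X\<^sup>2 + X^3) * (1 + s * y - r * Y\<^sup>2 + Y^3)"
    using P by (intro mult_mono order_trans [OF _ P(1)]) auto
  also have "\<dots> = 1 + s * x + s * y - r * (X\<^sup>2 + Y\<^sup>2) + s\<^sup>2 * (x * y) + (X^3 + Y^3
      + (- (s * r)) * (x * Y\<^sup>2) + s * (x * Y^3) + (- (s * r)) * (X\<^sup>2 * y) + (r * r) * (X\<^sup>2 * Y\<^sup>2)
      - r * (X\<^sup>2 * Y^3) + s * (X^3 * y) - r * (X^3 * Y\<^sup>2) + X^3 * Y^3)"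
    by (simp add: power2_eq_square algebra_simps)
  also have "\<dots> \<le> 1 + s * x + s * y - r * (X\<^sup>2 + Y\<^sup>2) + s\<^sup>2 * (x * y) + (X^3 + Y^3
      + X * Y\<^sup>2 + X * Y^3 + X\<^sup>2 * Y + X\<^sup>2 * Y\<^sup>2 + X^3 * Y + X^3 * Y^3)"
    using e1 e2 e3 e4 e5 e6 by linarith
  also have "\<dots> \<le> 1 + s * x + s * y - r * (X\<^sup>2 + Y\<^sup>2) + s\<^sup>2 * (x * y) + 10 * K^3 * (X^3 + Y^3)"
    using mult_cubic_bounds [of X K Y] x y K by (simp add: X_def Y_def)
  finally show ?thesis by (simp add: r_def X_def Y_def)
qed


subsection \<open>Martingale increments\<close>

text \<open>Every nonempty \<open>S\<close> is counted once, at its maximum \<open>m\<close>.\<close>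

lemma sum_maximum_Pow:
  fixes h :: "nat set \<Rightarrow> real"
  shows "(\<Sum>m<n. \<Sum>S\<in>Pow {..<m}. h (insert m S)) = sum h (Pow {..<n}) - h {}"
  by (induction n) (auto simp: sum_Pow_Suc)

context standardised
begin

lemma low_degree_fourth_moment:
  assumes M: "\<And>a. \<bar>\<phi> a\<bar> \<le> M" and r: "0 < r" "8 * r\<^sup>2 \<le> 2" "3 * M\<^sup>2 * r^4 \<le> 1"
    and c: "\<And>S. card S \<ge> d \<Longrightarrow> c S = 0"
  shows "r^(4 * d) * expect B n (\<lambda>w. (multilin \<phi> n c w)^4) \<le> (\<Sum>S\<in>Pow {..<n}. (c S)\<^sup>2)\<^sup>2"
proof -
  have r1: "r \<le> 1"
  proof (rule ccontr)
    assume "\<not> r \<le> 1"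
    then have "1 \<le> r\<^sup>2" by simp
    then show False using r by linarith
  qed
  define e where "e S = r^(d - card S) * c S" for S :: "nat set"
  have eq: "r ^ card S * e S = r^d * c S" for S :: "nat set"
  proof (cases "d \<le> card S")
    case False
    then have "r ^ card S * r^(d - card S) = r^d" by (simp flip: power_add)
    then show ?thesis by (simp only: e_def mult.assoc [symmetric])
  qed (simp add: c e_def)
  have "r^(4 * d) * (multilin \<phi> n c w)^4 = (multilin \<phi> n (\<lambda>S. r ^ card S * e S) w)^4" for w
  proof -
    have "multilin \<phi> n (\<lambda>S. r ^ card S * e S) w = r^d * multilin \<phi> n c w"
      by (simp only: eq) (simp add: multilin_def sum_distrib_left mult_ac)
    then show ?thesis by (simp only: power_mult_distrib mult.commute [of 4 d] power_mult)
  qed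
  then have "r^(4 * d) * expect B n (\<lambda>w. (multilin \<phi> n c w)^4) =
      expect B n (\<lambda>w. (multilin \<phi> n (\<lambda>S. r ^ card S * e S) w)^4)"
    by (simp only: integral_mult_right_zero [symmetric])
  also have "\<dots> \<le> (\<Sum>S\<in>Pow {..<n}. (e S)\<^sup>2)\<^sup>2"
    by (rule hypercontractive [OF M r(2,3)])
  also have "\<dots> \<le> (\<Sum>S\<in>Pow {..<n}. (c S)\<^sup>2)\<^sup>2"
  proof (rule power_mono, rule sum_mono)
    fix S :: "nat set"
    have "(r^(d - card S))\<^sup>2 \<le> 1" using r r1 by (intro power_le_one) (auto intro: power_le_one)
    then show "(e S)\<^sup>2 \<le> (c S)\<^sup>2"
      using mult_right_mono [of "(r^(d - card S))\<^sup>2" 1 "(c S)\<^sup>2"] by (simp add: e_def power_mult_distrib)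
  qed (simp add: sum_nonneg)
  finally show ?thesis .
qed

lemma third_moment:
  assumes M: "\<And>a. \<bar>\<phi> a\<bar> \<le> M" and r: "0 < r" "8 * r\<^sup>2 \<le> 2" "3 * M\<^sup>2 * r^4 \<le> 1"
    and D: "\<And>w. \<bar>multilin \<phi> n c w\<bar> \<le> 1" and l: "0 < l"
    and V: "(\<Sum>S\<in>Pow {..<n}. if card S < d then (c S)\<^sup>2 else 0) \<le> l\<^sup>2 * r^(4 * d)"
  shows "expect B n (\<lambda>w. \<bar>multilin \<phi> n c w\<bar>^3) \<le>
    8 * l * (\<Sum>S\<in>Pow {..<n}. if card S < d then (c S)\<^sup>2 else 0) +
    4 * (\<Sum>S\<in>Pow {..<n}. if card S < d then 0 else (c S)\<^sup>2)"
proof -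
  define cl where "cl S = (if card S < d then c S else 0)" for S
  define ch where "ch S = (if card S < d then 0 else c S)" for S
  define L where "L = multilin \<phi> n cl"
  define H where "H = multilin \<phi> n ch"
  define v where "v = (\<Sum>S\<in>Pow {..<n}. (cl S)\<^sup>2)"
  have v: "v = (\<Sum>S\<in>Pow {..<n}. if card S < d then (c S)\<^sup>2 else 0)"
    by (auto simp: v_def cl_def intro: sum.cong)
  have v0: "0 \<le> v" by (auto simp: v_def intro: sum_nonneg)
  have DLH: "multilin \<phi> n c w = L w + H w" for w
    unfolding L_def H_def multilin_add [symmetric] cl_def ch_def
    by (rule arg_cong [where f = "\<lambda>c. multilin \<phi> n c w"]) auto
  have pt: "\<bar>multilin \<phi> n c w\<bar>^3 \<le> 8 * \<bar>L w\<bar>^3 + 4 * (H w)\<^sup>2" for w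
  proof (cases "\<bar>H w\<bar> \<le> \<bar>L w\<bar>")
    case True
    then have "\<bar>multilin \<phi> n c w\<bar>^3 \<le> (2 * \<bar>L w\<bar>)^3" by (intro power_mono) (auto simp: DLH)
    then show ?thesis by (simp add: power_mult_distrib add_increasing2)
  next
    case False
    have "\<bar>multilin \<phi> n c w\<bar>^3 \<le> \<bar>multilin \<phi> n c w\<bar>^2" by (rule power_decreasing) (use D in auto)
    also have "\<dots> \<le> (2 * \<bar>H w\<bar>)^2" using False by (intro power_mono) (auto simp: DLH)
    finally show ?thesis by (simp add: power_mult_distrib add_increasing)
  qed
  have L2: "expect B n (\<lambda>w. (L w)\<^sup>2) = v" unfolding L_def v_def by (rule parseval)
  have L4: "r^(4 * d) * expect B n (\<lambda>w. (L w)^4) \<le> v\<^sup>2"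
    unfolding L_def v_def by (rule low_degree_fourth_moment [OF M r]) (auto simp: cl_def)
  have "v\<^sup>2 \<le> r^(4 * d) * (l\<^sup>2 * v)"
    using mult_right_mono [OF V [folded v] v0] by (simp add: power2_eq_square mult_ac)
  with L4 have "r^(4 * d) * expect B n (\<lambda>w. (L w)^4) \<le> r^(4 * d) * (l\<^sup>2 * v)" by linarith
  then have L4': "expect B n (\<lambda>w. (L w)^4) \<le> l\<^sup>2 * v" using r by simp
  have pt3: "\<bar>L w\<bar>^3 \<le> l / 2 * (L w)\<^sup>2 + 1 / (2 * l) * (L w)^4" for w
  proof -
    have "0 \<le> (L w)\<^sup>2 * (l - \<bar>L w\<bar>)\<^sup>2 / (2 * l)" using l by simp
    also have "\<dots> = l / 2 * \<bar>L w\<bar>\<^sup>2 + 1 / (2 * l) * \<bar>L w\<bar>^4 - \<bar>L w\<bar>^3"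
      unfolding power2_abs [symmetric, of "L w"] using l
      by (simp add: power2_eq_square power3_eq_cube power4_eq_xxxx field_simps del: abs_mult_self_eq)
    finally show ?thesis by simp
  qed
  have "expect B n (\<lambda>w. \<bar>multilin \<phi> n c w\<bar>^3) \<le> expect B n (\<lambda>w. 8 * \<bar>L w\<bar>^3 + 4 * (H w)\<^sup>2)"
    by (intro expect_mono pt)
  also have "\<dots> = 8 * expect B n (\<lambda>w. \<bar>L w\<bar>^3) + 4 * expect B n (\<lambda>w. (H w)\<^sup>2)" by simp
  also have "expect B n (\<lambda>w. \<bar>L w\<bar>^3) \<le> expect B n (\<lambda>w. l / 2 * (L w)\<^sup>2 + 1 / (2 * l) * (L w)^4)"
    by (intro expect_mono pt3)
  also have "\<dots> = l / 2 * v + 1 / (2 * l) * expect B n (\<lambda>w. (L w)^4)"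
    by (subst Bochner_Integration.integral_add) (simp_all add: L2)
  also have "\<dots> \<le> l / 2 * v + 1 / (2 * l) * (l\<^sup>2 * v)"
    using L4' l by (intro add_left_mono mult_left_mono) auto
  also have "\<dots> = l * v" using l by (simp add: power2_eq_square field_simps)
  also have "expect B n (\<lambda>w. (H w)\<^sup>2) = (\<Sum>S\<in>Pow {..<n}. (ch S)\<^sup>2)" unfolding H_def by (rule parseval)
  also have "\<dots> = (\<Sum>S\<in>Pow {..<n}. if card S < d then 0 else (c S)\<^sup>2)"
    by (auto simp: ch_def intro: sum.cong)
  finally show ?thesis by (simp add: v)
qed

lemma increment_le_1:
  assumes "\<And>w. multilin \<phi> m c w \<in> {0..1}" "\<And>w. multilin \<phi> (Suc m) c w \<in> {0..1}"
  shows "\<bar>multilin \<phi> m (\<lambda>S. c (insert m S)) w\<bar> \<le> 1"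
proof -
  define D where "D = multilin \<phi> m (\<lambda>S. c (insert m S)) w"
  have "(\<phi> a)\<^sup>2 * D\<^sup>2 \<le> 1" for a
  proof -
    have "multilin \<phi> (Suc m) c (w(m := a)) = multilin \<phi> m c w + \<phi> a * D"
      by (simp add: multilin_Suc D_def)
    then have "\<bar>\<phi> a * D\<bar> \<le> 1" using assms(1) [of w] assms(2) [of "w(m := a)"] by auto
    then have "(\<phi> a * D)\<^sup>2 \<le> 1" by (simp add: abs_square_le_1)
    then show ?thesis by (simp add: power_mult_distrib)
  qed
  then have "measure_pmf.expectation B (\<lambda>a. (\<phi> a)\<^sup>2 * D\<^sup>2) \<le> measure_pmf.expectation B (\<lambda>a. 1)"
    by (intro integral_mono) auto
  then have "D\<^sup>2 \<le> 1" using var by simp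
  then show ?thesis by (simp add: abs_square_le_1 D_def)
qed

end

subsection \<open>Two-function hypercontractivity up to cubic errors\<close>

locale correlated = F: standardised B \<phi> + G: standardised B \<psi> for B \<phi> \<psi> +
  fixes \<rho> :: real
  assumes corr: "measure_pmf.expectation B (\<lambda>a. \<phi> a * \<psi> a) = \<rho>"
begin

lemma expectation_affine_product:
  "measure_pmf.expectation B (\<lambda>a. (x + \<phi> a * u) * (y + \<psi> a * v)) = x * y + \<rho> * (u * v)"
proof -
  have "(\<lambda>a. (x + \<phi> a * u) * (y + \<psi> a * v)) =
      (\<lambda>a. x * y + ((u * y) * \<phi> a + ((x * v) * \<psi> a + (u * v) * (\<phi> a * \<psi> a))))"
    by (auto simp: algebra_simps)
  then show ?thesis using F.mean G.mean corr by simp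
qed

lemma plancherel:
  "expect B n (\<lambda>w. multilin \<phi> n c w * multilin \<psi> n e w) = (\<Sum>S\<in>Pow {..<n}. \<rho> ^ card S * (c S * e S))"
proof (induction n arbitrary: c e)
  case (Suc n)
  show ?case
    by (simp add: expect_Suc multilin_Suc expectation_affine_product Suc sum_Pow_Suc
        card_insert_Pow sum_distrib_left mult_ac)
qed (simp add: expect_0)

text \<open>
  For this \<open>s\<close> the quadratic part of the expansion is the nonpositive square
  \<open>- s (1 - s) / 2 * (u / a - v / b)\<^sup>2\<close>.
\<close>

lemma one_step:
  assumes \<rho>: "0 \<le> \<rho>" and s: "s = 1 / (1 + \<rho>)"
    and M: "\<And>z. \<bar>\<phi> z\<bar> \<le> M" "\<And>z. \<bar>\<psi> z\<bar> \<le> M"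
    and \<delta>: "0 < \<delta>" "\<delta> \<le> 1"
    and ab: "a \<in> {\<delta>..2}" "b \<in> {\<delta>..2}"
    and u: "\<And>z. a + \<phi> z * u \<in> {\<delta>..2}" and v: "\<And>z. b + \<psi> z * v \<in> {\<delta>..2}"
  shows "measure_pmf.expectation B (\<lambda>z. (a + \<phi> z * u) powr s * (b + \<psi> z * v) powr s) \<le>
    a powr s * b powr s + 320 * M^3 / \<delta>^6 * (\<bar>u\<bar>^3 + \<bar>v\<bar>^3)"
proof -
  have s01: "0 \<le> s" "s \<le> 1" using \<rho> by (auto simp: s)
  have s\<rho>: "s\<^sup>2 * \<rho> = s * (1 - s)" using \<rho> by (simp add: s power2_eq_square field_simps)
  have a0: "0 < a" "0 < b" using ab \<delta> by auto
  define K where "K = 2 / \<delta>"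
  have K: "1 \<le> K" using \<delta> by (simp add: K_def)
  define C where "C = 10 * K^3"
  have C: "0 \<le> C" using K by (simp add: C_def)
  define A where "A = u / a"
  define E where "E = v / b"
  have x1: "-1 < \<phi> z * A" and x2: "\<bar>\<phi> z * A\<bar> \<le> K" and xa: "a + \<phi> z * u = a * (1 + \<phi> z * A)" for z
  proof -
    show eq: "a + \<phi> z * u = a * (1 + \<phi> z * A)" using a0 by (simp add: A_def field_simps)
    have "0 < a * (1 + \<phi> z * A)" using u [of z] \<delta> unfolding eq [symmetric] by auto
    then show "-1 < \<phi> z * A" using a0 by (simp add: zero_less_mult_iff)
    have "\<bar>\<phi> z * u\<bar> \<le> 2" using u [of z] ab \<delta> by auto
    then show "\<bar>\<phi> z * A\<bar> \<le> K" using a0 ab \<delta> unfolding A_def K_def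
      by (auto simp: abs_mult abs_divide intro!: frac_le)
  qed
  have y1: "-1 < \<psi> z * E" and y2: "\<bar>\<psi> z * E\<bar> \<le> K" and yb: "b + \<psi> z * v = b * (1 + \<psi> z * E)" for z
  proof -
    show eq: "b + \<psi> z * v = b * (1 + \<psi> z * E)" using a0 by (simp add: E_def field_simps)
    have "0 < b * (1 + \<psi> z * E)" using v [of z] \<delta> unfolding eq [symmetric] by auto
    then show "-1 < \<psi> z * E" using a0 by (simp add: zero_less_mult_iff)
    have "\<bar>\<psi> z * v\<bar> \<le> 2" using v [of z] ab \<delta> by auto
    then show "\<bar>\<psi> z * E\<bar> \<le> K" using a0 ab \<delta> unfolding E_def K_def
      by (auto simp: abs_mult abs_divide intro!: frac_le)
  qed
  have M0: "0 \<le> M" using M(1) [of "(False, False)"] by linarith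
  have cube: "\<bar>f * t\<bar>^3 \<le> M^3 * \<bar>t\<bar>^3" if "\<bar>f\<bar> \<le> M" for f t :: real
    using that by (auto simp: abs_mult power_mult_distrib intro!: mult_right_mono power_mono)
  have pt: "(1 + \<phi> z * A) powr s * (1 + \<psi> z * E) powr s \<le>
      (1 + C * M^3 * (\<bar>A\<bar>^3 + \<bar>E\<bar>^3)) + ((s * A) * \<phi> z + ((s * E) * \<psi> z +
      ((- (s * (1 - s) / 2 * A\<^sup>2)) * (\<phi> z)\<^sup>2 + ((- (s * (1 - s) / 2 * E\<^sup>2)) * (\<psi> z)\<^sup>2 +
      (s\<^sup>2 * (A * E)) * (\<phi> z * \<psi> z)))))" for z
  proof -
    have "C * (\<bar>\<phi> z * A\<bar>^3 + \<bar>\<psi> z * E\<bar>^3) \<le> C * (M^3 * \<bar>A\<bar>^3 + M^3 * \<bar>E\<bar>^3)"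
      using C by (intro mult_left_mono add_mono cube M)
    then show ?thesis
      using powr_product_upper [OF x1 [of z] x2 [of z] y1 [of z] y2 [of z] K s01, folded C_def]
      by (simp add: power_mult_distrib algebra_simps)
  qed
  have "measure_pmf.expectation B (\<lambda>z. (1 + \<phi> z * A) powr s * (1 + \<psi> z * E) powr s) \<le>
      measure_pmf.expectation B (\<lambda>z. (1 + C * M^3 * (\<bar>A\<bar>^3 + \<bar>E\<bar>^3)) + ((s * A) * \<phi> z + ((s * E) * \<psi> z +
      ((- (s * (1 - s) / 2 * A\<^sup>2)) * (\<phi> z)\<^sup>2 + ((- (s * (1 - s) / 2 * E\<^sup>2)) * (\<psi> z)\<^sup>2 +
      (s\<^sup>2 * (A * E)) * (\<phi> z * \<psi> z))))))"
    by (intro integral_mono pt) auto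
  also have "\<dots> = (1 + C * M^3 * (\<bar>A\<bar>^3 + \<bar>E\<bar>^3)) +
      (- (s * (1 - s) / 2 * A\<^sup>2) + (- (s * (1 - s) / 2 * E\<^sup>2) + (s\<^sup>2 * (A * E)) * \<rho>))"
    by (subst Bochner_Integration.integral_add, simp, simp)+
       (simp only: integral_mult_right_zero F.mean F.var G.mean G.var corr, simp)
  also have "\<dots> = 1 + C * M^3 * (\<bar>A\<bar>^3 + \<bar>E\<bar>^3) - s * (1 - s) / 2 * (A - E)\<^sup>2"
  proof -
    have "(s\<^sup>2 * (A * E)) * \<rho> = (s * (1 - s)) * (A * E)" by (simp flip: s\<rho>)
    then show ?thesis by (simp add: power2_eq_square field_simps)
  qed
  also have "\<dots> \<le> 1 + C * M^3 * (\<bar>A\<bar>^3 + \<bar>E\<bar>^3)" using s01 by simp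
  finally have main: "measure_pmf.expectation B (\<lambda>z. (1 + \<phi> z * A) powr s * (1 + \<psi> z * E) powr s)
      \<le> 1 + C * M^3 * (\<bar>A\<bar>^3 + \<bar>E\<bar>^3)" .
  have pw: "t powr s \<le> 2" if "t \<in> {\<delta>..2}" for t
  proof -
    have "t powr s \<le> 2 powr s" using that \<delta> s01 by (intro powr_mono2) auto
    also have "\<dots> \<le> 2 powr 1" using s01 by (intro powr_mono) auto
    finally show ?thesis by simp
  qed
  have ab4: "a powr s * b powr s \<le> 2 * 2" using pw ab by (intro mult_mono) auto
  have AE: "\<bar>A\<bar>^3 \<le> \<bar>u\<bar>^3 / \<delta>^3" "\<bar>E\<bar>^3 \<le> \<bar>v\<bar>^3 / \<delta>^3"
    using ab \<delta> by (auto simp: A_def E_def power_divide abs_divide intro!: frac_le power_mono)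
  have "measure_pmf.expectation B (\<lambda>z. (a + \<phi> z * u) powr s * (b + \<psi> z * v) powr s) =
      (a powr s * b powr s) * measure_pmf.expectation B (\<lambda>z. (1 + \<phi> z * A) powr s * (1 + \<psi> z * E) powr s)"
  proof -
    have "(a + \<phi> z * u) powr s * (b + \<psi> z * v) powr s =
        (a powr s * b powr s) * ((1 + \<phi> z * A) powr s * (1 + \<psi> z * E) powr s)" for z
      using a0 x1 [of z] y1 [of z] by (simp add: xa yb powr_mult)
    then show ?thesis by simp
  qed
  also have "\<dots> \<le> (a powr s * b powr s) * (1 + C * M^3 * (\<bar>A\<bar>^3 + \<bar>E\<bar>^3))"
    using main by (intro mult_left_mono) auto
  also have "\<dots> = a powr s * b powr s + (a powr s * b powr s) * (C * M^3 * (\<bar>A\<bar>^3 + \<bar>E\<bar>^3))"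
    by (simp add: algebra_simps)
  also have "\<dots> \<le> a powr s * b powr s + (2 * 2) * (C * M^3 * (\<bar>u\<bar>^3 / \<delta>^3 + \<bar>v\<bar>^3 / \<delta>^3))"
  proof (rule add_left_mono, rule mult_mono [OF ab4])
    show "C * M^3 * (\<bar>A\<bar>^3 + \<bar>E\<bar>^3) \<le> C * M^3 * (\<bar>u\<bar>^3 / \<delta>^3 + \<bar>v\<bar>^3 / \<delta>^3)"
      using AE C M0 by (intro mult_left_mono add_mono) auto
  qed (use C M0 in auto)
  also have "\<dots> = a powr s * b powr s + 320 * M^3 / \<delta>^6 * (\<bar>u\<bar>^3 + \<bar>v\<bar>^3)"
  proof -
    have "\<delta>^6 = \<delta>^3 * \<delta>^3" by (simp flip: power_add)
    then show ?thesis
      by (simp only: C_def K_def power_divide) (simp add: distrib_left)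
  qed
  finally show ?thesis .
qed

lemma powr_product_iterated:
  assumes \<rho>: "0 \<le> \<rho>" and s: "s = 1 / (1 + \<rho>)"
    and M: "\<And>z. \<bar>\<phi> z\<bar> \<le> M" "\<And>z. \<bar>\<psi> z\<bar> \<le> M"
    and \<delta>: "0 < \<delta>" "\<delta> \<le> 1"
    and c: "\<And>m w. m \<le> n \<Longrightarrow> multilin \<phi> m c w \<in> {0..1}"
    and e: "\<And>m w. m \<le> n \<Longrightarrow> multilin \<psi> m e w \<in> {0..1}"
  shows "expect B n (\<lambda>w. (multilin \<phi> n c w + \<delta>) powr s * (multilin \<psi> n e w + \<delta>) powr s) \<le>
    (c {} + \<delta>) powr s * (e {} + \<delta>) powr s + 320 * M^3 / \<delta>^6 *
    (\<Sum>m<n. expect B m (\<lambda>w. \<bar>multilin \<phi> m (\<lambda>S. c (insert m S)) w\<bar>^3) +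
             expect B m (\<lambda>w. \<bar>multilin \<psi> m (\<lambda>S. e (insert m S)) w\<bar>^3))"
  using c e
proof (induction n)
  case 0
  show ?case by (simp add: expect_0)
next
  case (Suc n)
  define F where "F = multilin \<phi> n c"
  define G where "G = multilin \<psi> n e"
  define U where "U = multilin \<phi> n (\<lambda>S. c (insert n S))"
  define V where "V = multilin \<psi> n (\<lambda>S. e (insert n S))"
  define C where "C = 320 * M^3 / \<delta>^6"
  have "expect B (Suc n) (\<lambda>w. (multilin \<phi> (Suc n) c w + \<delta>) powr s * (multilin \<psi> (Suc n) e w + \<delta>) powr s) =
     expect B n (\<lambda>w. measure_pmf.expectation B
       (\<lambda>z. ((F w + \<delta>) + \<phi> z * U w) powr s * ((G w + \<delta>) + \<psi> z * V w) powr s))"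
    by (simp add: expect_Suc multilin_Suc F_def G_def U_def V_def algebra_simps)
  also have "\<dots> \<le> expect B n (\<lambda>w. (F w + \<delta>) powr s * (G w + \<delta>) powr s + C * (\<bar>U w\<bar>^3 + \<bar>V w\<bar>^3))"
  proof (intro expect_mono, unfold C_def, rule one_step [OF \<rho> s M \<delta>])
    fix w
    show "F w + \<delta> \<in> {\<delta>..2}" "G w + \<delta> \<in> {\<delta>..2}"
      using Suc.prems(1) [of n w] Suc.prems(2) [of n w] \<delta> by (auto simp: F_def G_def)
    fix z
    have eq: "multilin \<phi> (Suc n) c (w(n := z)) = F w + \<phi> z * U w"
      "multilin \<psi> (Suc n) e (w(n := z)) = G w + \<psi> z * V w"
      by (simp_all add: multilin_Suc F_def G_def U_def V_def)
    have "F w + \<phi> z * U w \<in> {0..1}" "G w + \<psi> z * V w \<in> {0..1}"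
      unfolding eq [symmetric] by (rule Suc.prems, simp)+
    then show "F w + \<delta> + \<phi> z * U w \<in> {\<delta>..2}" "G w + \<delta> + \<psi> z * V w \<in> {\<delta>..2}"
      using \<delta> by auto
  qed
  also have "\<dots> = expect B n (\<lambda>w. (F w + \<delta>) powr s * (G w + \<delta>) powr s) +
      C * (expect B n (\<lambda>w. \<bar>U w\<bar>^3) + expect B n (\<lambda>w. \<bar>V w\<bar>^3))"
    by simp
  finally show ?case
    using Suc.IH Suc.prems by (simp add: F_def G_def U_def V_def C_def algebra_simps)
qed

end


subsection \<open>Noise and low-degree influences\<close>

lemma coeff_hat_eq:
  "0 < p \<Longrightarrow> p < 1 \<Longrightarrow> S \<subseteq> {..<n} \<Longrightarrow>
    coeff_hat p n f S = (\<Sum>w\<in>cube n. bern_weight p n w * f w * (\<Prod>i\<in>S. chi p (w i)))"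
  by (rule expansion_unique [OF _ _ is_expansion_coeff_hat])

text \<open>The noise kernel \<open>1 + \<theta> \<chi>(w) \<chi>(z)\<close> is nonnegative and averages to one.\<close>

lemma noise_range:
  assumes p: "0 < p" "p < 1" and f: "\<And>z. z \<in> cube n \<Longrightarrow> f z \<in> {0..1}"
    and \<theta>: "\<And>i. 0 \<le> \<theta> i" "\<And>i. \<theta> i \<le> 1"
  shows "(\<Sum>S\<in>Pow {..<n}. (\<Prod>i\<in>S. \<theta> i) * coeff_hat p n f S * (\<Prod>i\<in>S. chi p (z i))) \<in> {0..1}"
proof -
  define h where "h i b = (if b then p else 1 - p) * (\<theta> i * (chi p b * chi p (z i)) + 1)" for i b
  define K where "K w = (\<Prod>i<n. h i (w i))" for w
  have s: "sqrt (p * (1 - p)) * sqrt (p * (1 - p)) = p * (1 - p)" "p * (1 - p) \<noteq> 0" using p by auto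
  have chi_ge: "chi p b * chi p b' \<ge> -1" for b b'
    using p s by (cases b; cases b') (auto simp: chi_def field_simps)
  have h0: "0 \<le> h i b" for i b
  proof -
    have "\<theta> i * (chi p b * chi p (z i)) \<ge> \<theta> i * (-1)" by (intro mult_left_mono chi_ge \<theta>)
    then show ?thesis unfolding h_def using p \<theta>(2) [of i] by (intro mult_nonneg_nonneg) auto
  qed
  have h1: "h i True + h i False = 1" for i
  proof -
    have "p * chi p True + (1 - p) * chi p False = 0" using p by (simp add: chi_def divide_simps)
    moreover have "h i True + h i False = \<theta> i * chi p (z i) * (p * chi p True + (1 - p) * chi p False) + 1"
      by (simp add: h_def algebra_simps)
    ultimately show ?thesis by simp
  qed
  have K0: "0 \<le> K w" for w unfolding K_def by (intro prod_nonneg h0)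
  have K1: "(\<Sum>w\<in>cube n. K w) = 1" unfolding K_def by (simp add: sum_cube_prod h1)
  have K_eq: "bern_weight p n w * (\<Sum>S\<in>Pow {..<n}. (\<Prod>i\<in>S. \<theta> i) * ((\<Prod>i\<in>S. chi p (w i)) * (\<Prod>i\<in>S. chi p (z i)))) = K w" for w
  proof -
    have "(\<Sum>S\<in>Pow {..<n}. (\<Prod>i\<in>S. \<theta> i) * ((\<Prod>i\<in>S. chi p (w i)) * (\<Prod>i\<in>S. chi p (z i))))
      = (\<Prod>i<n. \<theta> i * (chi p (w i) * chi p (z i)) + 1)"
      by (subst prod_add) (auto simp: prod.distrib)
    then show ?thesis by (simp add: bern_weight_def K_def h_def prod.distrib)
  qed
  have "(\<Sum>S\<in>Pow {..<n}. (\<Prod>i\<in>S. \<theta> i) * coeff_hat p n f S * (\<Prod>i\<in>S. chi p (z i))) =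
    (\<Sum>S\<in>Pow {..<n}. \<Sum>w\<in>cube n. f w * (bern_weight p n w *
      ((\<Prod>i\<in>S. \<theta> i) * ((\<Prod>i\<in>S. chi p (w i)) * (\<Prod>i\<in>S. chi p (z i))))))"
    using p by (intro sum.cong refl)
      (simp add: coeff_hat_eq sum_distrib_left sum_distrib_right mult_ac)
  also have "\<dots> = (\<Sum>w\<in>cube n. f w * K w)"
    by (subst sum.swap) (simp add: K_eq flip: sum_distrib_left)
  finally have eq: "(\<Sum>S\<in>Pow {..<n}. (\<Prod>i\<in>S. \<theta> i) * coeff_hat p n f S * (\<Prod>i\<in>S. chi p (z i))) =
    (\<Sum>w\<in>cube n. f w * K w)" .
  have "0 \<le> (\<Sum>w\<in>cube n. f w * K w)" using f K0 by (intro sum_nonneg mult_nonneg_nonneg) auto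
  moreover have "(\<Sum>w\<in>cube n. f w * K w) \<le> (\<Sum>w\<in>cube n. 1 * K w)"
    using f K0 by (intro sum_mono mult_right_mono) auto
  ultimately show ?thesis using K1 by (simp add: eq)
qed

definition noise_coeff :: "(nat \<Rightarrow> real) \<Rightarrow> real \<Rightarrow> nat \<Rightarrow> ((nat \<Rightarrow> bool) \<Rightarrow> real) \<Rightarrow> nat set \<Rightarrow> real" where
  "noise_coeff \<theta> p n f S = (\<Prod>i\<in>S. \<theta> i) * coeff_hat p n f S"

text \<open>
  Setting the rates to \<open>0\<close> from \<open>m\<close> on turns the noise operator into a conditional expectation,
  so the whole martingale stays in the unit interval.
\<close>

lemma multilin_noise_range:
  assumes p: "0 < p" "p < 1" and f: "\<And>z. z \<in> cube n \<Longrightarrow> f z \<in> {0..1}"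
    and \<theta>: "\<And>i. 0 \<le> \<theta> i" "\<And>i. \<theta> i \<le> 1" and m: "m \<le> n"
  shows "multilin (\<lambda>a. chi p (pr a)) m (noise_coeff \<theta> p n f) w \<in> {0..1}"
proof -
  define \<theta>' where "\<theta>' i = (if i < m then \<theta> i else 0)" for i
  have "multilin (\<lambda>a. chi p (pr a)) m (noise_coeff \<theta> p n f) w =
    (\<Sum>S\<in>Pow {..<m}. (\<Prod>i\<in>S. \<theta>' i) * coeff_hat p n f S * (\<Prod>i\<in>S. chi p (pr (w i))))"
    unfolding multilin_def noise_coeff_def
  proof (intro sum.cong refl arg_cong2 [where f = "(*)"] prod.cong)
    fix S i assume "S \<in> Pow {..<m}" "i \<in> S"
    then show "\<theta> i = \<theta>' i" by (auto simp: \<theta>'_def)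
  qed
  also have "\<dots> = (\<Sum>S\<in>Pow {..<n}. (\<Prod>i\<in>S. \<theta>' i) * coeff_hat p n f S * (\<Prod>i\<in>S. chi p (pr (w i))))"
  proof (rule sum.mono_neutral_left)
    show "\<forall>S\<in>Pow {..<n} - Pow {..<m}. (\<Prod>i\<in>S. \<theta>' i) * coeff_hat p n f S * (\<Prod>i\<in>S. chi p (pr (w i))) = 0"
    proof
      fix S assume S: "S \<in> Pow {..<n} - Pow {..<m}"
      then obtain i where "i \<in> S" "\<not> i < m" by auto
      moreover have "finite S" using S by (auto intro: finite_subset)
      ultimately have "(\<Prod>i\<in>S. \<theta>' i) = 0" by (intro prod_zero) (auto simp: \<theta>'_def)
      then show "(\<Prod>i\<in>S. \<theta>' i) * coeff_hat p n f S * (\<Prod>i\<in>S. chi p (pr (w i))) = 0" by simp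
    qed
  qed (use m in auto)
  also have "\<dots> \<in> {0..1}"
    using \<theta> by (intro noise_range p f) (auto simp: \<theta>'_def)
  finally show ?thesis .
qed

lemma multilin_coeff_hat:
  assumes p: "0 < p" "p < 1" and w: "(\<lambda>i. pr (w i)) \<in> cube n"
  shows "multilin (\<lambda>a. chi p (pr a)) n (coeff_hat p n f) w = f (\<lambda>i. pr (w i))"
  using is_expansion_coeff_hat [OF p, of n f] w by (simp add: is_expansion_def multilin_def)

lemma noise_coeff_square_le:
  assumes "S \<subseteq> {..<n}" "\<And>i. 0 \<le> \<theta> i" "\<And>i. \<theta> i \<le> 1"
  shows "(noise_coeff \<theta> p n f S)\<^sup>2 \<le> (coeff_hat p n f S)\<^sup>2"
proof -
  have "(\<Prod>i\<in>S. \<theta> i) \<le> 1" "0 \<le> (\<Prod>i\<in>S. \<theta> i)" using assms by (auto intro: prod_le_1 prod_nonneg)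
  then have "(\<Prod>i\<in>S. \<theta> i)\<^sup>2 \<le> 1" by (simp add: power_le_one)
  then show ?thesis
    using mult_right_mono [of "(\<Prod>i\<in>S. \<theta> i)\<^sup>2" 1 "(coeff_hat p n f S)\<^sup>2"]
    by (simp add: noise_coeff_def power_mult_distrib)
qed

lemma sum_coeff_hat_square_le:
  assumes std: "standardised B (\<lambda>a. chi p (pr a))"
    and p: "0 < p" "p < 1" and f: "\<And>z. z \<in> cube n \<Longrightarrow> f z \<in> {0..1}"
  shows "(\<Sum>S\<in>Pow {..<n}. (coeff_hat p n f S)\<^sup>2) \<le> 1"
proof -
  interpret standardised B "\<lambda>a. chi p (pr a)" by (rule std)
  have eq: "coeff_hat p n f = noise_coeff (\<lambda>_. 1) p n f" by (auto simp: noise_coeff_def)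
  then have rng: "multilin (\<lambda>a. chi p (pr a)) n (coeff_hat p n f) w \<in> {0..1}" for w
    unfolding eq by (intro multilin_noise_range p f) auto
  have "(\<Sum>S\<in>Pow {..<n}. (coeff_hat p n f S)\<^sup>2) =
      expect B n (\<lambda>w. (multilin (\<lambda>a. chi p (pr a)) n (coeff_hat p n f) w)\<^sup>2)"
    by (rule parseval [symmetric])
  also have "\<dots> \<le> expect B n (\<lambda>w. 1)"
    using rng by (intro expect_mono) (auto simp: power_le_one)
  finally show ?thesis by simp
qed

lemma low_deg_influence_nonneg: "0 \<le> low_deg_influence p n d i f"
  by (simp add: low_deg_influence_def sum_nonneg)

lemma low_deg_influence_alt:
  "i < n \<Longrightarrow> low_deg_influence p n d i f =
    (\<Sum>S\<in>Pow {..<n}. if i \<in> S \<and> card S \<le> d then (coeff_hat p n f S)\<^sup>2 else 0)"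
  by (simp add: low_deg_influence_def sum.If_cases Int_def)

lemma low_deg_influence_le:
  "i < n \<Longrightarrow> low_deg_influence p n d i f \<le> (\<Sum>S\<in>Pow {..<n}. (coeff_hat p n f S)\<^sup>2)"
  unfolding low_deg_influence_alt by (intro sum_mono) auto

lemma sum_low_deg_influence_le:
  "(\<Sum>i<n. low_deg_influence p n d i f) \<le> real d * (\<Sum>S\<in>Pow {..<n}. (coeff_hat p n f S)\<^sup>2)"
proof -
  have "(\<Sum>i<n. low_deg_influence p n d i f) =
      (\<Sum>i<n. \<Sum>S\<in>Pow {..<n}. if i \<in> S \<and> card S \<le> d then (coeff_hat p n f S)\<^sup>2 else 0)"
    by (intro sum.cong refl low_deg_influence_alt) auto
  also have "\<dots> = (\<Sum>S\<in>Pow {..<n}. \<Sum>i<n. if i \<in> S \<and> card S \<le> d then (coeff_hat p n f S)\<^sup>2 else 0)"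
    by (rule sum.swap)
  also have "\<dots> \<le> (\<Sum>S\<in>Pow {..<n}. real d * (coeff_hat p n f S)\<^sup>2)"
  proof (rule sum_mono)
    fix S assume S: "S \<in> Pow {..<n}"
    have "(\<Sum>i<n. if i \<in> S \<and> card S \<le> d then (coeff_hat p n f S)\<^sup>2 else 0) =
        (if card S \<le> d then (\<Sum>i\<in>{..<n} \<inter> S. (coeff_hat p n f S)\<^sup>2) else 0)"
      by (simp only: sum.inter_restrict [OF finite_lessThan]) simp
    also have "{..<n} \<inter> S = S" using S by auto
    finally show "(\<Sum>i<n. if i \<in> S \<and> card S \<le> d then (coeff_hat p n f S)\<^sup>2 else 0) \<le> real d * (coeff_hat p n f S)\<^sup>2"
      by (auto intro: mult_right_mono)
  qed
  finally show ?thesis by (simp add: sum_distrib_left)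
qed

lemma sum_third_moments:
  assumes std: "standardised B (\<lambda>a. chi p (pr a))"
    and p: "0 < p" "p < 1" and f: "\<And>z. z \<in> cube n \<Longrightarrow> f z \<in> {0..1}"
    and M: "\<And>b. \<bar>chi p b\<bar> \<le> M" and r: "0 < r" "8 * r\<^sup>2 \<le> 2" "3 * M\<^sup>2 * r^4 \<le> 1"
    and \<eta>: "0 \<le> \<eta>" "\<eta> \<le> 1" and \<theta>: "\<And>i. \<theta> i = 0 \<or> \<theta> i = \<eta>"
    and l: "0 < l"
    and inf: "\<And>i. i < n \<Longrightarrow> \<theta> i \<noteq> 0 \<Longrightarrow> low_deg_influence p n d i f \<le> l\<^sup>2 * r^(4 * d)"
  shows "(\<Sum>m<n. expect B m (\<lambda>w. \<bar>multilin (\<lambda>a. chi p (pr a)) m (\<lambda>S. noise_coeff \<theta> p n f (insert m S)) w\<bar>^3))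
    \<le> 8 * l + 4 * \<eta>^d"
proof -
  interpret standardised B "\<lambda>a. chi p (pr a)" by (rule std)
  define c where "c = noise_coeff \<theta> p n f"
  have \<theta>01: "0 \<le> \<theta> i" "\<theta> i \<le> 1" for i using \<theta> [of i] \<eta> by auto
  define V where "V m = (\<Sum>S\<in>Pow {..<m}. if card S < d then (c (insert m S))\<^sup>2 else 0)" for m
  define W where "W m = (\<Sum>S\<in>Pow {..<m}. if card S < d then 0 else (c (insert m S))\<^sup>2)" for m
  have csq: "(c S)\<^sup>2 \<le> (coeff_hat p n f S)\<^sup>2" if "S \<subseteq> {..<n}" for S
    unfolding c_def by (rule noise_coeff_square_le [OF that \<theta>01])
  have V_le: "V m \<le> l\<^sup>2 * r^(4 * d)" if m: "m < n" for m
  proof (cases "\<theta> m = 0")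
    case True
    have "c (insert m S) = 0" if "S \<in> Pow {..<m}" for S
      using that True by (auto simp: c_def noise_coeff_def intro!: prod_zero finite_subset [of S])
    then have "V m = 0" unfolding V_def by (intro sum.neutral) auto
    then show ?thesis using r by simp
  next
    case False
    have inj: "inj_on (insert m) (Pow {..<m})" by (auto simp: inj_on_def)
    have "V m \<le> (\<Sum>S\<in>Pow {..<m}. if card (insert m S) \<le> d then (coeff_hat p n f (insert m S))\<^sup>2 else 0)"
      unfolding V_def using m by (intro sum_mono) (auto simp: card_insert_Pow intro!: csq)
    also have "\<dots> = (\<Sum>S\<in>insert m ` Pow {..<m}. if m \<in> S \<and> card S \<le> d then (coeff_hat p n f S)\<^sup>2 else 0)"
      by (subst sum.reindex [OF inj]) auto
    also have "\<dots> \<le> (\<Sum>S\<in>Pow {..<n}. if m \<in> S \<and> card S \<le> d then (coeff_hat p n f S)\<^sup>2 else 0)"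
      using m by (intro sum_mono2) auto
    also have "\<dots> = low_deg_influence p n d m f" using m by (simp add: low_deg_influence_alt)
    also have "\<dots> \<le> l\<^sup>2 * r^(4 * d)" using inf m False by simp
    finally show ?thesis .
  qed
  have tm: "expect B m (\<lambda>w. \<bar>multilin (\<lambda>a. chi p (pr a)) m (\<lambda>S. c (insert m S)) w\<bar>^3) \<le> 8 * l * V m + 4 * W m"
    if m: "m < n" for m
    unfolding V_def W_def
  proof (rule third_moment [OF _ r _ l])
    show "\<bar>multilin (\<lambda>a. chi p (pr a)) m (\<lambda>S. c (insert m S)) w\<bar> \<le> 1" for w
      using m unfolding c_def by (intro increment_le_1 multilin_noise_range p f \<theta>01) auto
  qed (use M V_le [OF m, unfolded V_def] in auto)
  have "(\<Sum>m<n. V m) = (\<Sum>m<n. \<Sum>S\<in>Pow {..<m}. if card (insert m S) \<le> d then (c (insert m S))\<^sup>2 else 0)"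
    unfolding V_def by (intro sum.cong refl) (auto simp: card_insert_Pow)
  also have "\<dots> = (\<Sum>S\<in>Pow {..<n}. if card S \<le> d then (c S)\<^sup>2 else 0) - (c {})\<^sup>2"
    by (subst sum_maximum_Pow [where h = "\<lambda>S. if card S \<le> d then (c S)\<^sup>2 else 0"]) simp
  also have "\<dots> \<le> (\<Sum>S\<in>Pow {..<n}. if card S \<le> d then (c S)\<^sup>2 else 0)" by simp
  also have "\<dots> \<le> (\<Sum>S\<in>Pow {..<n}. (coeff_hat p n f S)\<^sup>2)"
    by (intro sum_mono) (auto intro: csq)
  also have "\<dots> \<le> 1" by (rule sum_coeff_hat_square_le [OF std p f])
  finally have V1: "(\<Sum>m<n. V m) \<le> 1" .
  have "(\<Sum>m<n. W m) = (\<Sum>m<n. \<Sum>S\<in>Pow {..<m}. if card (insert m S) \<le> d then 0 else (c (insert m S))\<^sup>2)"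
    unfolding W_def by (intro sum.cong refl) (auto simp: card_insert_Pow)
  also have "\<dots> = (\<Sum>S\<in>Pow {..<n}. if card S \<le> d then 0 else (c S)\<^sup>2)"
    by (subst sum_maximum_Pow [where h = "\<lambda>S. if card S \<le> d then 0 else (c S)\<^sup>2"]) simp
  also have "\<dots> \<le> (\<Sum>S\<in>Pow {..<n}. \<eta>^d * (coeff_hat p n f S)\<^sup>2)"
  proof (rule sum_mono)
    fix S assume S: "S \<in> Pow {..<n}"
    have "(c S)\<^sup>2 \<le> \<eta>^d * (coeff_hat p n f S)\<^sup>2" if "\<not> card S \<le> d"
    proof -
      have "(\<Prod>i\<in>S. \<theta> i) \<le> (\<Prod>i\<in>S. \<eta>)" using \<theta> \<eta> \<theta>01 by (intro prod_mono) (metis order_refl)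
      also have "\<dots> \<le> \<eta>^d" using that \<eta> by (simp add: power_decreasing)
      finally have le: "(\<Prod>i\<in>S. \<theta> i) \<le> \<eta>^d" .
      have nn: "0 \<le> (\<Prod>i\<in>S. \<theta> i)" "(\<Prod>i\<in>S. \<theta> i) \<le> 1" using \<theta>01 by (auto intro: prod_nonneg prod_le_1)
      have "(\<Prod>i\<in>S. \<theta> i)\<^sup>2 \<le> \<eta>^d * 1" unfolding power2_eq_square using le nn \<eta> by (intro mult_mono) auto
      then show ?thesis
        using mult_right_mono [of "(\<Prod>i\<in>S. \<theta> i)\<^sup>2" "\<eta>^d" "(coeff_hat p n f S)\<^sup>2"]
        by (simp add: c_def noise_coeff_def power_mult_distrib)
    qed
    then show "(if card S \<le> d then 0 else (c S)\<^sup>2) \<le> \<eta>^d * (coeff_hat p n f S)\<^sup>2" using \<eta> by auto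
  qed
  also have "\<dots> \<le> \<eta>^d * 1"
    unfolding sum_distrib_left [symmetric] using \<eta>
    by (intro mult_left_mono sum_coeff_hat_square_le [OF std p f]) auto
  finally have W1: "(\<Sum>m<n. W m) \<le> \<eta>^d" by simp
  have "(\<Sum>m<n. expect B m (\<lambda>w. \<bar>multilin (\<lambda>a. chi p (pr a)) m (\<lambda>S. c (insert m S)) w\<bar>^3)) \<le>
      (\<Sum>m<n. 8 * l * V m + 4 * W m)"
    by (intro sum_mono tm) auto
  also have "\<dots> = 8 * l * (\<Sum>m<n. V m) + 4 * (\<Sum>m<n. W m)"
    by (simp add: sum.distrib sum_distrib_left)
  also have "\<dots> \<le> 8 * l * 1 + 4 * \<eta>^d"
    using V1 W1 l by (intro add_mono mult_left_mono) auto
  finally show ?thesis by (simp add: c_def)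
qed

lemma power_difference_bound:
  fixes \<rho> \<eta> :: real
  assumes \<rho>: "0 \<le> \<rho>" "\<rho> < 1" and \<eta>: "0 \<le> \<eta>" "\<eta> \<le> 1"
  shows "\<rho>^t * (1 - (\<eta>^t)\<^sup>2) \<le> 2 * (1 - \<eta>) / (1 - \<rho>)"
proof -
  have a: "1 - \<eta>^m \<le> real m * (1 - \<eta>)" for m
  proof (induction m)
    case (Suc m)
    have "1 - \<eta>^Suc m = (1 - \<eta>^m) + \<eta>^m * (1 - \<eta>)" by (simp add: algebra_simps)
    also have "\<dots> \<le> real m * (1 - \<eta>) + 1 * (1 - \<eta>)"
      using Suc \<eta> by (intro add_mono mult_right_mono) (auto simp: power_le_one)
    finally show ?case by (simp add: algebra_simps)
  qed simp
  have b: "real t * \<rho>^t * (1 - \<rho>) \<le> 1 - \<rho>^t" for t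
  proof (induction t)
    case (Suc t)
    have "real t * \<rho>^Suc t * (1 - \<rho>) \<le> real t * \<rho>^t * (1 - \<rho>)"
      using \<rho> by (intro mult_right_mono mult_left_mono) (auto intro: mult_left_le_one_le)
    moreover have "\<rho>^Suc t * (1 - \<rho>) \<le> \<rho>^t * (1 - \<rho>)"
      using \<rho> by (intro mult_right_mono) (auto intro: mult_left_le_one_le)
    ultimately show ?case using Suc by (simp add: algebra_simps)
  qed simp
  have "\<rho>^t * (1 - (\<eta>^t)\<^sup>2) = \<rho>^t * (1 - \<eta>^(2 * t))" by (simp add: power_mult [symmetric] mult.commute)
  also have "\<dots> \<le> \<rho>^t * (real (2 * t) * (1 - \<eta>))" using \<rho> by (intro mult_left_mono a) auto
  also have "\<dots> = 2 * (1 - \<eta>) * (real t * \<rho>^t * (1 - \<rho>)) / (1 - \<rho>)" using \<rho> by simp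
  also have "\<dots> \<le> 2 * (1 - \<eta>) * 1 / (1 - \<rho>)"
  proof (intro divide_right_mono mult_left_mono)
    show "real t * \<rho>^t * (1 - \<rho>) \<le> 1" using b [of t] \<rho> by (smt (verit) zero_le_power)
  qed (use \<rho> \<eta> in auto)
  finally show ?thesis by simp
qed

lemma abs_mult_le_weighted:
  fixes a b k :: real
  assumes "0 < k"
  shows "\<bar>a * b\<bar> \<le> (k * a\<^sup>2 + b\<^sup>2 / k) / 2"
proof -
  have "0 \<le> (k * \<bar>a\<bar> - \<bar>b\<bar>)\<^sup>2 / (2 * k)" using assms by simp
  also have "\<dots> = (k * \<bar>a\<bar>\<^sup>2 + \<bar>b\<bar>\<^sup>2 / k) / 2 - \<bar>a\<bar> * \<bar>b\<bar>"
    using assms by (simp add: power2_eq_square field_simps del: abs_mult_self_eq)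
  finally show ?thesis by (simp add: abs_mult)
qed

text \<open>
  The coordinates in \<open>Bad\<close> are averaged out; this is cheap because at each of them one of the two
  functions has tiny influence.
\<close>

lemma sum_noise_difference:
  fixes \<rho> \<eta> \<kappa> :: real
  assumes f: "(\<Sum>S\<in>Pow {..<n}. (coeff_hat p n f S)\<^sup>2) \<le> 1"
    and g: "(\<Sum>S\<in>Pow {..<n}. (coeff_hat p' n g S)\<^sup>2) \<le> 1"
    and \<rho>: "0 \<le> \<rho>" "\<rho> < 1" and \<eta>: "0 \<le> \<eta>" "\<eta> \<le> 1" and \<kappa>: "0 < \<kappa>"
    and \<theta>: "\<theta> = (\<lambda>i. if i \<in> Bad then 0 else \<eta>)" and Bad: "Bad \<subseteq> {..<n}"
    and inf: "\<And>i. i < n \<Longrightarrow> low_deg_influence p n d i f \<le> \<kappa>\<^sup>2 \<or> low_deg_influence p' n d i g \<le> \<kappa>\<^sup>2"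
  shows "(\<Sum>S\<in>Pow {..<n}. \<rho> ^ card S * (coeff_hat p n f S * coeff_hat p' n g S)) \<le>
    (\<Sum>S\<in>Pow {..<n}. \<rho> ^ card S * (noise_coeff \<theta> p n f S * noise_coeff \<theta> p' n g S)) +
    2 * (1 - \<eta>) / (1 - \<rho>) + \<rho>^d + real (card Bad) * \<kappa>"
proof -
  define a where "a S = \<bar>coeff_hat p n f S * coeff_hat p' n g S\<bar>" for S
  have a0: "0 \<le> a S" for S by (simp add: a_def)
  have fin: "finite Bad" using Bad by (auto intro: finite_subset)
  define K where "K = 2 * (1 - \<eta>) / (1 - \<rho>)"
  have K0: "0 \<le> K" using \<eta> \<rho> by (simp add: K_def)
  have termwise: "\<rho> ^ card S * (coeff_hat p n f S * coeff_hat p' n g S) \<le>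
      \<rho> ^ card S * (noise_coeff \<theta> p n f S * noise_coeff \<theta> p' n g S) +
      (K * a S + \<rho>^d * a S + (\<Sum>m\<in>Bad. if m \<in> S \<and> card S \<le> d then a S else 0))"
    if S: "S \<in> Pow {..<n}" for S
  proof -
    define P where "P = (\<Prod>i\<in>S. \<theta> i)"
    have finS: "finite S" using S by (auto intro: finite_subset)
    have P: "0 \<le> P" "P \<le> 1" using \<eta> by (auto simp: P_def \<theta> intro!: prod_nonneg prod_le_1)
    have P2: "P\<^sup>2 \<le> 1" using P by (simp add: power_le_one)
    have "\<rho> ^ card S * (coeff_hat p n f S * coeff_hat p' n g S) -
      \<rho> ^ card S * (noise_coeff \<theta> p n f S * noise_coeff \<theta> p' n g S) =
      (\<rho> ^ card S * (1 - P\<^sup>2)) * (coeff_hat p n f S * coeff_hat p' n g S)"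
      by (simp add: noise_coeff_def P_def power2_eq_square algebra_simps)
    also have "\<dots> \<le> (\<rho> ^ card S * (1 - P\<^sup>2)) * a S"
      using \<rho> P2 by (intro mult_left_mono) (auto simp: a_def)
    also have "\<dots> \<le> K * a S + \<rho>^d * a S + (\<Sum>m\<in>Bad. if m \<in> S \<and> card S \<le> d then a S else 0)"
    proof -
      have s0: "0 \<le> (\<Sum>m\<in>Bad. if m \<in> S \<and> card S \<le> d then a S else 0)"
        by (intro sum_nonneg) (auto simp: a0)
      have n1: "0 \<le> K * a S" "0 \<le> \<rho>^d * a S" using K0 \<rho> a0 by auto
      show ?thesis
      proof (cases "S \<inter> Bad = {}")
        case True
        then have "P = (\<Prod>i\<in>S. \<eta>)" unfolding P_def by (intro prod.cong) (auto simp: \<theta>)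
        then have "\<rho> ^ card S * (1 - P\<^sup>2) \<le> K"
          using power_difference_bound [OF \<rho> \<eta>, of "card S"] by (simp add: K_def)
        then have "(\<rho> ^ card S * (1 - P\<^sup>2)) * a S \<le> K * a S" by (intro mult_right_mono a0)
        then show ?thesis using s0 n1 by linarith
      next
        case False
        show ?thesis
        proof (cases "card S \<le> d")
          case True
          from False obtain m where m: "m \<in> S" "m \<in> Bad" by auto
          have "\<rho> ^ card S * (1 - P\<^sup>2) \<le> 1 * 1" using \<rho> P2 by (intro mult_mono) (auto simp: power_le_one)
          then have "(\<rho> ^ card S * (1 - P\<^sup>2)) * a S \<le> 1 * a S" by (intro mult_right_mono a0) auto
          also have "1 * a S = (if m \<in> S \<and> card S \<le> d then a S else 0)" using m True by simp
          also have "\<dots> \<le> (\<Sum>m\<in>Bad. if m \<in> S \<and> card S \<le> d then a S else 0)"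
            using m by (intro member_le_sum fin) (auto simp: a0)
          finally show ?thesis using n1 by linarith
        next
          case False
          have "\<rho> ^ card S * (1 - P\<^sup>2) \<le> \<rho>^d * 1"
            using \<rho> P2 False by (intro mult_mono) (auto intro: power_decreasing)
          then have "(\<rho> ^ card S * (1 - P\<^sup>2)) * a S \<le> \<rho>^d * 1 * a S" by (intro mult_right_mono a0)
          then show ?thesis using s0 n1 by simp
        qed
      qed
    qed
    finally show ?thesis by simp
  qed
  have a1: "(\<Sum>S\<in>Pow {..<n}. a S) \<le> 1"
  proof -
    have "(\<Sum>S\<in>Pow {..<n}. a S) \<le> (\<Sum>S\<in>Pow {..<n}. ((coeff_hat p n f S)\<^sup>2 + (coeff_hat p' n g S)\<^sup>2) / 2)"
      unfolding a_def using abs_mult_le_weighted [of 1] by (intro sum_mono) simp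
    also have "\<dots> = ((\<Sum>S\<in>Pow {..<n}. (coeff_hat p n f S)\<^sup>2) + (\<Sum>S\<in>Pow {..<n}. (coeff_hat p' n g S)\<^sup>2)) / 2"
      by (simp only: sum.distrib sum_divide_distrib [symmetric])
    also have "\<dots> \<le> 1" using f g by simp
    finally show ?thesis .
  qed
  have bad: "(\<Sum>S\<in>Pow {..<n}. if m \<in> S \<and> card S \<le> d then a S else 0) \<le> \<kappa>" if "m \<in> Bad" for m
  proof -
    have m: "m < n" using that Bad by auto
    have weighted: "(\<Sum>S\<in>Pow {..<n}. if m \<in> S \<and> card S \<le> d then a S else 0) \<le>
        (k * low_deg_influence p n d m f + low_deg_influence p' n d m g / k) / 2" if "0 < k" for k
    proof -
      have "(\<Sum>S\<in>Pow {..<n}. if m \<in> S \<and> card S \<le> d then a S else 0) \<le>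
        (\<Sum>S\<in>Pow {..<n}. (k * (if m \<in> S \<and> card S \<le> d then (coeff_hat p n f S)\<^sup>2 else 0) +
          (if m \<in> S \<and> card S \<le> d then (coeff_hat p' n g S)\<^sup>2 else 0) / k) / 2)"
        using abs_mult_le_weighted [OF that] by (intro sum_mono) (auto simp: a_def)
      also have "\<dots> = (k * low_deg_influence p n d m f + low_deg_influence p' n d m g / k) / 2"
        unfolding low_deg_influence_alt [OF m]
        by (simp only: sum_divide_distrib [symmetric] sum.distrib sum_distrib_left [symmetric])
      finally show ?thesis .
    qed
    have le1: "low_deg_influence p n d m f \<le> 1" "low_deg_influence p' n d m g \<le> 1"
      using low_deg_influence_le [OF m, of p d f] low_deg_influence_le [OF m, of p' d g] f g by linarith+
    from inf [OF m] show ?thesis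
    proof
      assume A: "low_deg_influence p' n d m g \<le> \<kappa>\<^sup>2"
      have "\<kappa> * low_deg_influence p n d m f \<le> \<kappa> * 1" using le1 \<kappa> by (intro mult_left_mono) auto
      moreover have "low_deg_influence p' n d m g / \<kappa> \<le> \<kappa>"
        using A \<kappa> by (simp add: divide_le_eq power2_eq_square)
      ultimately show ?thesis using weighted [OF \<kappa>] by simp
    next
      assume A: "low_deg_influence p n d m f \<le> \<kappa>\<^sup>2"
      have "\<kappa> * low_deg_influence p' n d m g \<le> \<kappa>" using mult_left_mono [OF le1(2), of \<kappa>] \<kappa> by simp
      moreover have "low_deg_influence p n d m f / \<kappa> \<le> \<kappa>"
        using A \<kappa> by (simp add: divide_le_eq power2_eq_square)
      moreover have "2 * (\<Sum>S\<in>Pow {..<n}. if m \<in> S \<and> card S \<le> d then a S else 0) \<le>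
          low_deg_influence p n d m f / \<kappa> + \<kappa> * low_deg_influence p' n d m g"
        using weighted [of "1 / \<kappa>"] \<kappa> by (simp add: mult.commute)
      ultimately show ?thesis by linarith
    qed
  qed
  have "(\<Sum>S\<in>Pow {..<n}. \<rho> ^ card S * (coeff_hat p n f S * coeff_hat p' n g S)) \<le>
    (\<Sum>S\<in>Pow {..<n}. \<rho> ^ card S * (noise_coeff \<theta> p n f S * noise_coeff \<theta> p' n g S) +
      (K * a S + \<rho>^d * a S + (\<Sum>m\<in>Bad. if m \<in> S \<and> card S \<le> d then a S else 0)))"
    by (intro sum_mono termwise)
  also have "\<dots> = (\<Sum>S\<in>Pow {..<n}. \<rho> ^ card S * (noise_coeff \<theta> p n f S * noise_coeff \<theta> p' n g S)) +
      (K * (\<Sum>S\<in>Pow {..<n}. a S) + \<rho>^d * (\<Sum>S\<in>Pow {..<n}. a S) +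
       (\<Sum>S\<in>Pow {..<n}. \<Sum>m\<in>Bad. if m \<in> S \<and> card S \<le> d then a S else 0))"
    by (simp only: sum.distrib sum_distrib_left)
  also have "(\<Sum>S\<in>Pow {..<n}. \<Sum>m\<in>Bad. if m \<in> S \<and> card S \<le> d then a S else 0) =
      (\<Sum>m\<in>Bad. \<Sum>S\<in>Pow {..<n}. if m \<in> S \<and> card S \<le> d then a S else 0)"
    by (rule sum.swap)
  also have "\<dots> \<le> (\<Sum>m\<in>Bad. \<kappa>)" by (intro sum_mono bad)
  also have "K * (\<Sum>S\<in>Pow {..<n}. a S) \<le> K * 1" by (intro mult_left_mono a1 K0)
  also have "\<rho>^d * (\<Sum>S\<in>Pow {..<n}. a S) \<le> \<rho>^d * 1" using \<rho> by (intro mult_left_mono a1) auto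
  finally show ?thesis by (simp add: K_def)
qed


subsection \<open>Pairs of functions without common influential coordinates\<close>

lemma set_power_pmf_cube:
  assumes "w \<in> set_pmf (power_pmf n B)"
  shows "fst \<circ> w \<in> cube n" "snd \<circ> w \<in> cube n"
proof -
  have "\<forall>x. x \<notin> {..<n} \<longrightarrow> w x = (False, False)"
    using assms set_Pi_pmf_subset [of "{..<n}" "(False, False)" "\<lambda>_. B"] by (auto simp: power_pmf_def)
  then show "fst \<circ> w \<in> cube n" "snd \<circ> w \<in> cube n"
    by (auto simp: cube_def PiE_dflt_def)
qed

locale correlated_bits =
  correlated B "\<lambda>a. chi p (fst a)" "\<lambda>a. chi p' (snd a)" \<rho> for B p p' \<rho> +
  assumes p: "0 < p" "p < 1" and p': "0 < p'" "p' < 1"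
begin

lemma expect_product:
  "expect B n (\<lambda>w. f (fst \<circ> w) * g (snd \<circ> w)) =
    (\<Sum>S\<in>Pow {..<n}. \<rho> ^ card S * (coeff_hat p n f S * coeff_hat p' n g S))"
proof -
  have "expect B n (\<lambda>w. f (fst \<circ> w) * g (snd \<circ> w)) = expect B n (\<lambda>w.
    multilin (\<lambda>a. chi p (fst a)) n (coeff_hat p n f) w * multilin (\<lambda>a. chi p' (snd a)) n (coeff_hat p' n g) w)"
  proof (rule integral_cong_AE)
    show "AE w in measure_pmf (power_pmf n B). f (fst \<circ> w) * g (snd \<circ> w) =
      multilin (\<lambda>a. chi p (fst a)) n (coeff_hat p n f) w * multilin (\<lambda>a. chi p' (snd a)) n (coeff_hat p' n g) w"
      unfolding AE_measure_pmf_iff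
    proof
      fix w assume "w \<in> set_pmf (power_pmf n B)"
      then have "(\<lambda>i. fst (w i)) \<in> cube n" "(\<lambda>i. snd (w i)) \<in> cube n"
        using set_power_pmf_cube by (auto simp: comp_def)
      then show "f (fst \<circ> w) * g (snd \<circ> w) =
        multilin (\<lambda>a. chi p (fst a)) n (coeff_hat p n f) w * multilin (\<lambda>a. chi p' (snd a)) n (coeff_hat p' n g) w"
        using p p' by (simp add: multilin_coeff_hat comp_def)
    qed
  qed auto
  then show ?thesis by (simp only: plancherel)
qed

lemma expect_product_le_of_parameters:
  assumes \<rho>: "0 \<le> \<rho>" "\<rho> < 1" and s: "s = 1 / (1 + \<rho>)"
    and f: "\<And>z. z \<in> cube n \<Longrightarrow> f z \<in> {0..1}" and g: "\<And>z. z \<in> cube n \<Longrightarrow> g z \<in> {0..1}"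
    and M: "\<And>b. \<bar>chi p b\<bar> \<le> M" "\<And>b. \<bar>chi p' b\<bar> \<le> M"
    and r: "0 < r" "8 * r\<^sup>2 \<le> 2" "3 * M\<^sup>2 * r^4 \<le> 1"
    and \<delta>: "0 < \<delta>" "\<delta> \<le> 1" and \<eta>: "0 \<le> \<eta>" "\<eta> \<le> 1" and l: "0 < l" and \<kappa>: "0 < \<kappa>"
    and t: "t = l\<^sup>2 * r^(4 * d)"
    and inf: "\<And>i. i < n \<Longrightarrow> low_deg_influence p n d i f \<le> \<kappa>\<^sup>2 \<or> low_deg_influence p' n d i g \<le> \<kappa>\<^sup>2"
  shows "expect B n (\<lambda>w. f (fst \<circ> w) * g (snd \<circ> w)) \<le>
    (coeff_hat p n f {} + \<delta>) powr s * (coeff_hat p' n g {} + \<delta>) powr s +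
    640 * M^3 / \<delta>^6 * (8 * l + 4 * \<eta>^d) + 2 * (1 - \<eta>) / (1 - \<rho>) + \<rho>^d + 2 * real d / t * \<kappa>"
proof -
  have t0: "0 < t" using l r by (simp add: t)
  have f1: "(\<Sum>S\<in>Pow {..<n}. (coeff_hat p n f S)\<^sup>2) \<le> 1"
    by (rule sum_coeff_hat_square_le [OF F.standardised_axioms p f])
  have g1: "(\<Sum>S\<in>Pow {..<n}. (coeff_hat p' n g S)\<^sup>2) \<le> 1"
    by (rule sum_coeff_hat_square_le [OF G.standardised_axioms p' g])
  define Bad where "Bad = {i. i < n \<and> (low_deg_influence p n d i f > t \<or> low_deg_influence p' n d i g > t)}"
  have BadS: "Bad \<subseteq> {..<n}" by (auto simp: Bad_def)
  have "real (card Bad) * t = (\<Sum>i\<in>Bad. t)" by simp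
  also have "\<dots> \<le> (\<Sum>i\<in>Bad. low_deg_influence p n d i f + low_deg_influence p' n d i g)"
    by (intro sum_mono) (auto simp: Bad_def low_deg_influence_nonneg add_increasing add_increasing2 less_imp_le)
  also have "\<dots> \<le> (\<Sum>i<n. low_deg_influence p n d i f + low_deg_influence p' n d i g)"
    using BadS by (intro sum_mono2) (auto simp: low_deg_influence_nonneg)
  also have "\<dots> \<le> real d * 1 + real d * 1"
    unfolding sum.distrib
    using f1 g1 by (intro add_mono order_trans [OF sum_low_deg_influence_le] mult_left_mono) auto
  finally have "real (card Bad) \<le> 2 * real d / t" using t0 by (simp add: field_simps)
  then have card: "real (card Bad) * \<kappa> \<le> 2 * real d / t * \<kappa>" using \<kappa> by (intro mult_right_mono) auto
  define \<theta> where "\<theta> = (\<lambda>i. if i \<in> Bad then 0 else \<eta>)"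
  have \<theta>01: "0 \<le> \<theta> i" "\<theta> i \<le> 1" and \<theta>: "\<theta> i = 0 \<or> \<theta> i = \<eta>" for i using \<eta> by (auto simp: \<theta>_def)
  define c where "c = noise_coeff \<theta> p n f"
  define e where "e = noise_coeff \<theta> p' n g"
  define F where "F = multilin (\<lambda>a. chi p (fst a)) n c"
  define G where "G = multilin (\<lambda>a. chi p' (snd a)) n e"
  have c01: "multilin (\<lambda>a. chi p (fst a)) m c w \<in> {0..1}" if "m \<le> n" for m w
    unfolding c_def by (rule multilin_noise_range [OF p f \<theta>01 that])
  have e01: "multilin (\<lambda>a. chi p' (snd a)) m e w \<in> {0..1}" if "m \<le> n" for m w
    unfolding e_def by (rule multilin_noise_range [OF p' g \<theta>01 that])
  have s01: "0 \<le> s" "s \<le> 1" using \<rho> by (auto simp: s)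
  have le_powr: "x \<le> (x + \<delta>) powr s" if "x \<in> {0..1}" for x :: real
  proof (cases "x + \<delta> \<le> 1")
    case True
    then have "(x + \<delta>) powr 1 \<le> (x + \<delta>) powr s" using that \<delta> s01 by (intro powr_mono') auto
    then show ?thesis using that \<delta> by simp
  next
    case False
    then have "1 \<le> (x + \<delta>) powr s" using s01 by (intro ge_one_powr_ge_zero) auto
    then show ?thesis using that by simp
  qed
  have tf: "(\<Sum>m<n. expect B m (\<lambda>w. \<bar>multilin (\<lambda>a. chi p (fst a)) m (\<lambda>S. c (insert m S)) w\<bar>^3)) \<le> 8 * l + 4 * \<eta>^d"
    unfolding c_def
  proof (rule sum_third_moments [OF F.standardised_axioms p f M(1) r \<eta> \<theta> l])
    show "low_deg_influence p n d i f \<le> l\<^sup>2 * r^(4 * d)" if "i < n" "\<theta> i \<noteq> 0" for i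
      using that by (auto simp: \<theta>_def Bad_def t split: if_splits)
  qed
  have tg: "(\<Sum>m<n. expect B m (\<lambda>w. \<bar>multilin (\<lambda>a. chi p' (snd a)) m (\<lambda>S. e (insert m S)) w\<bar>^3)) \<le> 8 * l + 4 * \<eta>^d"
    unfolding e_def
  proof (rule sum_third_moments [OF G.standardised_axioms p' g M(2) r \<eta> \<theta> l])
    show "low_deg_influence p' n d i g \<le> l\<^sup>2 * r^(4 * d)" if "i < n" "\<theta> i \<noteq> 0" for i
      using that by (auto simp: \<theta>_def Bad_def t split: if_splits)
  qed
  have M0: "0 \<le> M" using M(1) [of True] by linarith
  have "expect B n (\<lambda>w. f (fst \<circ> w) * g (snd \<circ> w)) \<le>
    (\<Sum>S\<in>Pow {..<n}. \<rho> ^ card S * (c S * e S)) + 2 * (1 - \<eta>) / (1 - \<rho>) + \<rho>^d + real (card Bad) * \<kappa>"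
    unfolding expect_product c_def e_def
    by (rule sum_noise_difference [OF f1 g1 \<rho> \<eta> \<kappa> \<theta>_def BadS inf])
  also have "(\<Sum>S\<in>Pow {..<n}. \<rho> ^ card S * (c S * e S)) = expect B n (\<lambda>w. F w * G w)"
    unfolding F_def G_def by (rule plancherel [symmetric])
  also have "\<dots> \<le> expect B n (\<lambda>w. (F w + \<delta>) powr s * (G w + \<delta>) powr s)"
  proof (rule expect_mono)
    fix w
    have "F w \<in> {0..1}" "G w \<in> {0..1}" using c01 [of n w] e01 [of n w] by (auto simp: F_def G_def)
    then show "F w * G w \<le> (F w + \<delta>) powr s * (G w + \<delta>) powr s"
      by (intro mult_mono le_powr) auto
  qed
  also have "\<dots> \<le> (c {} + \<delta>) powr s * (e {} + \<delta>) powr s + 320 * M^3 / \<delta>^6 *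
    (\<Sum>m<n. expect B m (\<lambda>w. \<bar>multilin (\<lambda>a. chi p (fst a)) m (\<lambda>S. c (insert m S)) w\<bar>^3) +
             expect B m (\<lambda>w. \<bar>multilin (\<lambda>a. chi p' (snd a)) m (\<lambda>S. e (insert m S)) w\<bar>^3))"
    unfolding F_def G_def by (rule powr_product_iterated [OF \<rho>(1) s M \<delta> c01 e01])
  also have "\<dots> \<le> (c {} + \<delta>) powr s * (e {} + \<delta>) powr s + 320 * M^3 / \<delta>^6 *
      ((8 * l + 4 * \<eta>^d) + (8 * l + 4 * \<eta>^d))"
    unfolding sum.distrib using tf tg M0 \<delta>
    by (intro add_left_mono mult_left_mono add_mono tf tg) auto
  also have "\<dots> = (c {} + \<delta>) powr s * (e {} + \<delta>) powr s + 640 * M^3 / \<delta>^6 * (8 * l + 4 * \<eta>^d)"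
    by simp
  also have "c {} = coeff_hat p n f {}" by (simp add: c_def noise_coeff_def)
  also have "e {} = coeff_hat p' n g {}" by (simp add: e_def noise_coeff_def)
  finally show ?thesis using card by linarith
qed

proposition no_common_influence_bound:
  assumes \<rho>: "0 \<le> \<rho>" "\<rho> < 1" and \<delta>: "0 < \<delta>" "\<delta> \<le> 1" and \<epsilon>: "0 < \<epsilon>"
  shows "\<exists>d. \<exists>\<tau>>0. \<forall>n f g. (\<forall>z\<in>cube n. f z \<in> {0..1}) \<longrightarrow> (\<forall>z\<in>cube n. g z \<in> {0..1}) \<longrightarrow>
    (\<forall>i<n. low_deg_influence p n d i f < \<tau> \<or> low_deg_influence p' n d i g < \<tau>) \<longrightarrow>
    expect B n (\<lambda>w. f (fst \<circ> w) * g (snd \<circ> w)) \<le>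
      (coeff_hat p n f {} + \<delta>) powr (1 / (1 + \<rho>)) * (coeff_hat p' n g {} + \<delta>) powr (1 / (1 + \<rho>)) + \<epsilon>"
proof -
  define M where "M = Max ((\<lambda>b. \<bar>chi p b\<bar>) ` UNIV \<union> (\<lambda>b. \<bar>chi p' b\<bar>) ` UNIV)"
  have M: "\<bar>chi p b\<bar> \<le> M" "\<bar>chi p' b\<bar> \<le> M" for b unfolding M_def by (auto intro!: Max_ge)
  have M0: "0 \<le> M" using M(1) [of True] by linarith
  define r where "r = 1 / (2 * (1 + M))"
  have r0: "0 < r" using M0 by (simp add: r_def)
  have r12: "r \<le> 1 / 2" "M * r \<le> 1 / 2" using M0 by (auto simp: r_def field_simps)
  have rsq: "r\<^sup>2 \<le> (1 / 2)\<^sup>2" "(M * r)\<^sup>2 \<le> (1 / 2)\<^sup>2" using r12 r0 M0 by (auto intro!: power_mono)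
  have r: "0 < r" "8 * r\<^sup>2 \<le> 2" "3 * M\<^sup>2 * r^4 \<le> 1"
  proof -
    have "3 * M\<^sup>2 * r^4 = 3 * ((M * r)\<^sup>2 * r\<^sup>2)" by (simp add: power2_eq_square power4_eq_xxxx)
    also have "\<dots> \<le> 3 * ((1 / 2)\<^sup>2 * (1 / 2)\<^sup>2)" by (intro mult_left_mono mult_mono rsq) auto
    finally show "3 * M\<^sup>2 * r^4 \<le> 1" by (simp add: power2_eq_square)
  qed (use r0 rsq in \<open>auto simp: power2_eq_square\<close>)
  define C where "C = 640 * M^3 / \<delta>^6"
  have C0: "0 \<le> C" using M0 \<delta> by (simp add: C_def)
  define u where "u = min \<epsilon> 1 / 10"
  have u: "0 < u" "u < 1" "5 * u < \<epsilon>" using \<epsilon> by (auto simp: u_def min_def)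
  define \<eta> where "\<eta> = 1 - u * (1 - \<rho>) / 2"
  have "u * (1 - \<rho>) \<le> 1 * 1" using u \<rho> by (intro mult_mono) auto
  then have \<eta>: "0 \<le> \<eta>" "\<eta> < 1" using u \<rho> by (auto simp: \<eta>_def)
  have \<eta>u: "2 * (1 - \<eta>) / (1 - \<rho>) = u" using \<rho> by (simp add: \<eta>_def)
  define l where "l = u / (8 * (C + 1))"
  have l: "0 < l" using u C0 by (simp add: l_def)
  have Cl: "C * (8 * l) \<le> u"
  proof -
    have "C * (8 * l) = C / (C + 1) * u" using C0 by (simp add: l_def field_simps)
    also have "\<dots> \<le> 1 * u" using C0 u by (intro mult_right_mono) auto
    finally show ?thesis by simp
  qed
  have lim: "(\<lambda>d. C * (4 * \<eta>^d)) \<longlonglongrightarrow> C * (4 * 0)" "(\<lambda>d. \<rho>^d) \<longlonglongrightarrow> 0"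
    using \<eta> \<rho> by (intro tendsto_mult tendsto_const LIMSEQ_power_zero; simp)+
  have "eventually (\<lambda>d. C * (4 * \<eta>^d) < u \<and> \<rho>^d < u) sequentially"
    using order_tendstoD(2) [OF lim(1), of u] order_tendstoD(2) [OF lim(2), of u] u
    by (auto intro: eventually_conj)
  then obtain d where d: "C * (4 * \<eta>^d) < u" "\<rho>^d < u"
    by (auto simp: eventually_sequentially)
  define t where "t = l\<^sup>2 * r^(4 * d)"
  have t: "0 < t" using l r by (simp add: t_def)
  define \<kappa> where "\<kappa> = u / (2 * real d / t + 1)"
  have dt: "0 \<le> 2 * real d / t" using t by simp
  have \<kappa>: "0 < \<kappa>" using u dt by (simp add: \<kappa>_def add_nonneg_pos)
  have d\<kappa>: "2 * real d / t * \<kappa> \<le> u"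
  proof -
    have "2 * real d / t * \<kappa> = (2 * real d / t) / (2 * real d / t + 1) * u" by (simp add: \<kappa>_def)
    also have "\<dots> \<le> 1 * u"
    proof (rule mult_right_mono)
      have "x / (x + 1) \<le> 1" if "0 \<le> x" for x :: real using that by (simp add: divide_le_eq_1)
      then show "(2 * real d / t) / (2 * real d / t + 1) \<le> 1" using dt by blast
    qed (use u in simp)
    finally show ?thesis by simp
  qed
  show ?thesis
  proof (intro exI [of _ d] exI [of _ "\<kappa>\<^sup>2"] conjI allI impI)
    fix n f g
    assume "\<forall>z\<in>cube n. f z \<in> {0..1}" "\<forall>z\<in>cube n. g z \<in> {0..1}"
      and inf: "\<forall>i<n. low_deg_influence p n d i f < \<kappa>\<^sup>2 \<or> low_deg_influence p' n d i g < \<kappa>\<^sup>2"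
    then have "expect B n (\<lambda>w. f (fst \<circ> w) * g (snd \<circ> w)) \<le>
      (coeff_hat p n f {} + \<delta>) powr (1 / (1 + \<rho>)) * (coeff_hat p' n g {} + \<delta>) powr (1 / (1 + \<rho>)) +
      640 * M^3 / \<delta>^6 * (8 * l + 4 * \<eta>^d) + 2 * (1 - \<eta>) / (1 - \<rho>) + \<rho>^d + 2 * real d / t * \<kappa>"
      using \<eta> by (intro expect_product_le_of_parameters [OF \<rho> refl _ _ M r \<delta> _ _ l \<kappa> t_def]) (auto intro: less_imp_le)
    moreover have "640 * M^3 / \<delta>^6 * (8 * l + 4 * \<eta>^d) \<le> 2 * u"
      using Cl d(1) unfolding C_def [symmetric] by (simp add: algebra_simps)
    ultimately show "expect B n (\<lambda>w. f (fst \<circ> w) * g (snd \<circ> w)) \<le>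
      (coeff_hat p n f {} + \<delta>) powr (1 / (1 + \<rho>)) * (coeff_hat p' n g {} + \<delta>) powr (1 / (1 + \<rho>)) + \<epsilon>"
      using \<eta>u d(2) d\<kappa> u(3) by linarith
  qed (use \<kappa> in auto)
qed

end

lemma chi_inverse:
  assumes "2 \<le> q"
  shows "chi (1 / real q) True = sqrt (real q - 1)" "chi (1 / real q) False = - 1 / sqrt (real q - 1)"
proof -
  have q: "real q \<ge> 2" using assms by simp
  have "1 / real q * (1 - 1 / real q) = (real q - 1) / (real q)\<^sup>2"
    using q by (simp add: field_simps power2_eq_square)
  then have "sqrt (1 / real q * (1 - 1 / real q)) = sqrt (real q - 1) / real q"
    using q by (simp add: real_sqrt_divide)
  then show "chi (1 / real q) True = sqrt (real q - 1)" "chi (1 / real q) False = - 1 / sqrt (real q - 1)"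
    using q by (auto simp: chi_def field_simps)
qed

lemma chi_half: "chi (1 / 2) True = 1" "chi (1 / 2) False = - 1"
  by (auto simp: chi_def real_sqrt_divide real_sqrt_mult field_simps)

lemma expectation_bool_prod:
  "measure_pmf.expectation B h = pmf B (False, False) * h (False, False) + pmf B (False, True) * h (False, True)
     + pmf B (True, False) * h (True, False) + pmf B (True, True) * h (True, True)"
  for h :: "bool \<times> bool \<Rightarrow> real"
  by (subst integral_measure_pmf [of UNIV])
     (auto simp: UNIV_Times_UNIV [symmetric] UNIV_bool sum.cartesian_product [symmetric] simp del: UNIV_Times_UNIV)

lemma correlated_bits_BY:
  assumes q: "2 \<le> q"
  shows "correlated_bits (BY q) (1 / real q) (1 / 2) (0.95 / sqrt (real q - 1))"
proof -
  define t where "t = sqrt (real q - 1)"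
  define m where "m = 1 / real q"
  have t: "t > 0" "real q = t\<^sup>2 + 1" using q by (auto simp: t_def)
  have m: "m * (t\<^sup>2 + 1) = 1" using q by (simp add: m_def flip: t(2))
  have mt: "m * t\<^sup>2 = 1 - m" using m by (simp add: algebra_simps)
  have w: "pmf (BY q) (False, True) = m * (t\<^sup>2 - 0.95) / 2"
    "pmf (BY q) (False, False) = m * (t\<^sup>2 + 0.95) / 2"
    "pmf (BY q) (True, True) = m * 1.95 / 2"
    "pmf (BY q) (True, False) = m * 0.05 / 2"
    using q unfolding right_diff_distrib distrib_left mt
    by (simp_all add: pmf_BY [OF q] BY_weight_def m_def field_simps)
  note moment = expectation_bool_prod fst_conv snd_conv w chi_inverse [OF q, folded t_def] chi_half
  have "measure_pmf.expectation (BY q) (\<lambda>a. chi (1 / real q) (fst a)) = 0"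
    using t(1) unfolding moment by (simp add: field_simps power2_eq_square)
  moreover have "measure_pmf.expectation (BY q) (\<lambda>a. (chi (1 / real q) (fst a))\<^sup>2) = m * (t\<^sup>2 + 1)"
    using t(1) unfolding moment by (simp add: field_simps power2_eq_square)
  moreover have "measure_pmf.expectation (BY q) (\<lambda>a. chi (1 / 2) (snd a)) = 0"
    unfolding moment by (simp add: field_simps)
  moreover have "measure_pmf.expectation (BY q) (\<lambda>a. (chi (1 / 2) (snd a))\<^sup>2) = m * (t\<^sup>2 + 1)"
    unfolding moment by (simp add: field_simps)
  moreover have "measure_pmf.expectation (BY q) (\<lambda>a. chi (1 / real q) (fst a) * chi (1 / 2) (snd a)) =
      0.95 / t * (m * (t\<^sup>2 + 1))"
    using t(1) unfolding moment by (simp add: field_simps power2_eq_square)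
  ultimately show ?thesis
    unfolding m unfolding t_def by unfold_locales (use q in auto)
qed

lemma correlated_bits_BN:
  assumes q: "2 \<le> q"
  shows "correlated_bits (BN q) (1 / real q) (1 / 2) 0"
proof -
  define t where "t = sqrt (real q - 1)"
  define m where "m = 1 / real q"
  have t: "t > 0" "real q = t\<^sup>2 + 1" using q by (auto simp: t_def)
  have m: "m * (t\<^sup>2 + 1) = 1" using q by (simp add: m_def flip: t(2))
  have mt: "m * t\<^sup>2 = 1 - m" using m by (simp add: algebra_simps)
  have w: "pmf (BN q) (True, b) = m / 2" "pmf (BN q) (False, b) = m * t\<^sup>2 / 2" for b
    using q unfolding mt by (simp_all add: BN_def pmf_pair m_def)
  note moment = expectation_bool_prod fst_conv snd_conv w chi_inverse [OF q, folded t_def] chi_half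
  have "measure_pmf.expectation (BN q) (\<lambda>a. chi (1 / real q) (fst a)) = 0"
    using t(1) unfolding moment by (simp add: field_simps power2_eq_square)
  moreover have "measure_pmf.expectation (BN q) (\<lambda>a. (chi (1 / real q) (fst a))\<^sup>2) = m * (t\<^sup>2 + 1)"
    using t(1) unfolding moment by (simp add: field_simps power2_eq_square)
  moreover have "measure_pmf.expectation (BN q) (\<lambda>a. chi (1 / 2) (snd a)) = 0"
    unfolding moment by (simp add: field_simps)
  moreover have "measure_pmf.expectation (BN q) (\<lambda>a. (chi (1 / 2) (snd a))\<^sup>2) = m * (t\<^sup>2 + 1)"
    unfolding moment by (simp add: field_simps)
  moreover have "measure_pmf.expectation (BN q) (\<lambda>a. chi (1 / real q) (fst a) * chi (1 / 2) (snd a)) = 0"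
    using t(1) unfolding moment by (simp add: field_simps power2_eq_square)
  ultimately show ?thesis
    unfolding m by unfold_locales (use q in auto)
qed


subsection \<open>Strategy vectors and the communication bound\<close>

lemma finite_bitstrings [simp]: "finite (bitstrings k)"
  using finite_lists_length_eq [of "UNIV :: bool set" k] by (simp add: bitstrings_def)

lemma card_bitstrings: "card (bitstrings k) = 2 ^ k"
  using card_lists_length_eq [of "UNIV :: bool set" k] by (simp add: bitstrings_def)

lemma sum_bitstrings_Suc:
  fixes h :: "bool list \<Rightarrow> real"
  shows "sum h (bitstrings (Suc j)) = (\<Sum>m\<in>bitstrings j. h (False # m)) + (\<Sum>m\<in>bitstrings j. h (True # m))"
proof -
  have "bitstrings (Suc j) = (#) False ` bitstrings j \<union> (#) True ` bitstrings j"
    by (auto simp: bitstrings_def length_Suc_conv image_iff)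
  then show ?thesis
    by (simp only:) (subst sum.union_disjoint, auto simp: sum.reindex inj_on_def)
qed

lemma hatA_mult_hatB:
  assumes x: "x \<in> KtildeA k" and y: "y \<in> KtildeB k" and l: "length l + j = k"
  shows "hatA k x l * hatB k y l = (\<Sum>m\<in>bitstrings j. x (l @ m) * y (l @ m))"
  using l
proof (induction j arbitrary: l)
  case 0
  then show ?case by (simp add: hatA.simps [of k x l] hatB.simps [of k y l] bitstrings_def)
next
  case (Suc j)
  have "hatA k x l * hatB k y l =
      hatA k x (l @ [False]) * hatB k y (l @ [False]) + hatA k x (l @ [True]) * hatB k y (l @ [True])"
  proof (cases "even (length l)")
    case True
    then have "hatB k y (l @ [False]) = hatB k y (l @ [True])"
      using y Suc.prems by (simp add: KtildeB_def)
    then show ?thesis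
      using True Suc.prems by (subst hatA.simps, subst hatB.simps) (simp add: algebra_simps)
  next
    case False
    then have "hatA k x (l @ [False]) = hatA k x (l @ [True])"
      using x Suc.prems by (simp add: KtildeA_def)
    then show ?thesis
      using False Suc.prems by (subst hatA.simps, subst hatB.simps) (simp add: algebra_simps)
  qed
  also have "\<dots> = (\<Sum>m\<in>bitstrings (Suc j). x (l @ m) * y (l @ m))"
    using Suc.IH [of "l @ [False]"] Suc.IH [of "l @ [True]"] Suc.prems
    by (simp add: sum_bitstrings_Suc)
  finally show ?case .
qed

lemma KA_range: "a \<in> KA k \<Longrightarrow> l \<in> bitstrings k \<Longrightarrow> a l \<in> {0..1}"
  by (force simp: KA_def KtildeA_def mask_def PiE_def Pi_def)

lemma KB_range: "b \<in> KB k \<Longrightarrow> l \<in> bitstrings k \<Longrightarrow> b l \<in> {0..1}"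
  by (force simp: KB_def KtildeB_def mask_def PiE_def Pi_def)

lemma dotp_le_1:
  assumes a: "a \<in> KA k" and b: "b \<in> KB k"
  shows "dotp k a b \<le> 1"
proof -
  obtain x y where x: "x \<in> KtildeA k" "a = mask k x" and y: "y \<in> KtildeB k" "b = mask k y"
    using a b by (auto simp: KA_def KB_def)
  have nn: "0 \<le> x l" "0 \<le> y l" if "l \<in> bitstrings k" for l
    using x(1) y(1) that by (auto simp: KtildeA_def KtildeB_def PiE_def Pi_def)
  have "dotp k a b \<le> (\<Sum>l\<in>bitstrings k. x l * y l)"
    unfolding dotp_def x(2) y(2) by (intro sum_mono) (auto simp: mask_def nn)
  also have "\<dots> = hatA k x [] * hatB k y []"
    using hatA_mult_hatB [OF x(1) y(1), of "[]" k] by simp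
  also have "\<dots> = 1" using x y by (simp add: KtildeA_def KtildeB_def)
  finally show ?thesis .
qed

lemma two_powr_le_affine:
  fixes u :: real
  assumes "0 \<le> u" "u \<le> 1"
  shows "2 powr u \<le> 1 + u"
proof (cases "u = 0 \<or> u = 1")
  case False
  then show ?thesis
    using Youngs_inequality_0 [of u "1 - u" 2 1] assms by simp
qed auto

text \<open>Tangent line of \<open>t powr s\<close> at \<open>1 / card A\<close>.\<close>

lemma sum_powr_le:
  fixes t :: "'a \<Rightarrow> real"
  assumes A: "finite A" "A \<noteq> {}" and s: "0 \<le> s" "s \<le> 1" and t: "\<And>l. l \<in> A \<Longrightarrow> 0 < t l"
  shows "(\<Sum>l\<in>A. t l powr s) \<le> real (card A) powr (1 - s) * (s * sum t A + (1 - s))"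
proof -
  define N where "N = real (card A)"
  have N: "0 < N" using A by (simp add: N_def card_gt_0_iff)
  have "t l powr s \<le> N powr (1 - s) * (s * t l + (1 - s) * (1 / N))" if "l \<in> A" for l
  proof -
    have "t l powr s * (1 / N) powr (1 - s) \<le> s * t l + (1 - s) * (1 / N)"
      using s t [OF that] N by (intro Youngs_inequality_0) auto
    then show ?thesis using N by (simp add: powr_divide field_simps)
  qed
  then have "(\<Sum>l\<in>A. t l powr s) \<le> (\<Sum>l\<in>A. N powr (1 - s) * (s * t l + (1 - s) * (1 / N)))"
    by (rule sum_mono)
  also have "\<dots> = N powr (1 - s) * (s * sum t A + (1 - s))"
    using N by (simp only: sum_distrib_left [symmetric] sum.distrib sum_constant) (simp add: N_def)
  finally show ?thesis by (simp add: N_def)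
qed

lemma success_le:
  assumes q: "2 \<le> q" and k: "1 \<le> k" "real k \<le> u / 2 * sqrt (real q)" and u: "0 \<le> u" "u \<le> 1"
    and \<delta>: "0 < \<delta>" "\<delta> \<le> 1" and \<rho>: "\<rho> = 0.95 / sqrt (real q - 1)" and s: "s = 1 / (1 + \<rho>)"
    and f: "f \<in> cube n \<rightarrow> KA k" and g: "g \<in> cube n \<rightarrow> KB k"
    and bound: "\<And>l. l \<in> bitstrings k \<Longrightarrow>
      expect (BY q) n (\<lambda>w. f (fst \<circ> w) l * g (snd \<circ> w) l) \<le>
      (coeff_hat (1 / real q) n (\<lambda>x. f x l) {} + \<delta>) powr s * (coeff_hat (1 / 2) n (\<lambda>y. g y l) {} + \<delta>) powr s + \<epsilon>"
  shows "success k (power_pmf n (BY q)) (power_pmf n (BN q)) f g \<le> 3 * u + 2 ^ k * (6 * \<delta> + \<epsilon>)"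
proof -
  interpret Y: correlated_bits "BY q" "1 / real q" "1 / 2" "0.95 / sqrt (real q - 1)"
    by (rule correlated_bits_BY [OF q])
  interpret N: correlated_bits "BN q" "1 / real q" "1 / 2" 0
    by (rule correlated_bits_BN [OF q])
  define a where "a l = coeff_hat (1 / real q) n (\<lambda>x. f x l) {}" for l
  define b where "b l = coeff_hat (1 / 2) n (\<lambda>y. g y l) {}" for l
  have frange: "f z l \<in> {0..1}" if "z \<in> cube n" "l \<in> bitstrings k" for z l
    using f that KA_range by blast
  have grange: "g z l \<in> {0..1}" if "z \<in> cube n" "l \<in> bitstrings k" for z l
    using g that KB_range by blast
  have a01: "a l \<in> {0..1}" if "l \<in> bitstrings k" for l
    using multilin_noise_range [OF Y.p, of n "\<lambda>x. f x l" "\<lambda>_. 1" 0] frange [OF _ that]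
    by (simp add: noise_coeff_def a_def)
  have b01: "b l \<in> {0..1}" if "l \<in> bitstrings k" for l
    using multilin_noise_range [OF Y.p', of n "\<lambda>x. g x l" "\<lambda>_. 1" 0] grange [OF _ that]
    by (simp add: noise_coeff_def b_def)
  have expect_dotp: "expect B n (\<lambda>w. dotp k (f (fst \<circ> w)) (g (snd \<circ> w))) =
    (\<Sum>l\<in>bitstrings k. expect B n (\<lambda>w. f (fst \<circ> w) l * g (snd \<circ> w) l))" for B
    unfolding dotp_def by (rule Bochner_Integration.integral_sum) simp
  have N_eq: "expect (BN q) n (\<lambda>w. f (fst \<circ> w) l * g (snd \<circ> w) l) = a l * b l" for l
  proof -
    have "expect (BN q) n (\<lambda>w. f (fst \<circ> w) l * g (snd \<circ> w) l) =
        (\<Sum>S\<in>Pow {..<n}. 0 ^ card S * (coeff_hat (1 / real q) n (\<lambda>x. f x l) S * coeff_hat (1 / 2) n (\<lambda>y. g y l) S))"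
      using N.expect_product [of n "\<lambda>x. f x l" "\<lambda>y. g y l"] by simp
    also have "\<dots> = (\<Sum>S\<in>{{}}. 0 ^ card S * (coeff_hat (1 / real q) n (\<lambda>x. f x l) S * coeff_hat (1 / 2) n (\<lambda>y. g y l) S))"
      by (rule sum.mono_neutral_right) (auto simp: power_0_left card_eq_0_iff dest: finite_subset)
    finally show ?thesis by (simp add: a_def b_def)
  qed
  define T where "T = (\<Sum>l\<in>bitstrings k. a l * b l)"
  have T: "0 \<le> T" "T \<le> 1"
  proof -
    show "0 \<le> T" unfolding T_def using a01 b01 by (intro sum_nonneg mult_nonneg_nonneg) auto
    have "T = expect (BN q) n (\<lambda>w. dotp k (f (fst \<circ> w)) (g (snd \<circ> w)))"
      by (simp add: expect_dotp N_eq T_def)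
    also have "\<dots> \<le> expect (BN q) n (\<lambda>w. 1)"
    proof (rule integral_mono_AE)
      show "AE w in measure_pmf (power_pmf n (BN q)). dotp k (f (fst \<circ> w)) (g (snd \<circ> w)) \<le> 1"
        unfolding AE_measure_pmf_iff using f g set_power_pmf_cube by (blast intro: dotp_le_1)
    qed auto
    finally show "T \<le> 1" by simp
  qed
  have \<rho>0: "0 \<le> \<rho>" using q by (simp add: \<rho>)
  have \<rho>_le: "\<rho> * sqrt (real q) \<le> 2"
  proof -
    have "sqrt (real q) \<le> sqrt (4 * (real q - 1))" using q by (intro real_sqrt_le_mono) simp
    then have "sqrt (real q) \<le> 2 * sqrt (real q - 1)" by (simp only: real_sqrt_mult real_sqrt_four)
    then have "\<rho> * sqrt (real q) \<le> \<rho> * (2 * sqrt (real q - 1))" using \<rho>0 by (rule mult_left_mono)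
    also have "\<dots> \<le> 2" using q by (simp add: \<rho>)
    finally show ?thesis .
  qed
  have k\<rho>: "real k * \<rho> \<le> u"
  proof -
    have "real k * \<rho> \<le> u / 2 * sqrt (real q) * \<rho>" using k \<rho>0 by (intro mult_right_mono) auto
    also have "\<dots> = u / 2 * (\<rho> * sqrt (real q))" by simp
    also have "\<dots> \<le> u / 2 * 2" using u \<rho>_le by (intro mult_left_mono) auto
    finally show ?thesis by simp
  qed
  have \<rho>u: "\<rho> \<le> u" using k\<rho> k(1) \<rho>0 mult_right_mono [of 1 "real k" \<rho>] by simp
  have s01: "0 < s" "s \<le> 1" using \<rho>0 by (auto simp: s)
  have s\<rho>: "1 - s \<le> \<rho>" using \<rho>0 by (simp add: s field_simps)
  define Q where "Q = real (card (bitstrings k)) powr (1 - s)"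
  have Q: "0 \<le> Q" "Q \<le> 1 + u"
  proof -
    have "Q = 2 powr (real k * (1 - s))" by (simp add: Q_def card_bitstrings powr_powr flip: powr_realpow)
    also have "\<dots> \<le> 2 powr u"
      using k\<rho> mult_left_mono [OF s\<rho>, of "real k"] by (intro powr_mono) auto
    also have "\<dots> \<le> 1 + u" by (rule two_powr_le_affine [OF u])
    finally show "Q \<le> 1 + u" .
  qed (simp add: Q_def)
  define t where "t l = (a l + \<delta>) * (b l + \<delta>)" for l
  have t0: "0 < t l" if "l \<in> bitstrings k" for l
    using a01 [OF that] b01 [OF that] \<delta> by (simp add: t_def)
  have t_le: "t l \<le> a l * b l + 3 * \<delta>" if "l \<in> bitstrings k" for l
  proof -
    have "\<delta> * a l \<le> \<delta> * 1" "\<delta> * b l \<le> \<delta> * 1" "\<delta> * \<delta> \<le> \<delta> * 1"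
      using a01 [OF that] b01 [OF that] \<delta> by (intro mult_left_mono; simp)+
    then show ?thesis by (simp add: t_def algebra_simps)
  qed
  have "sum t (bitstrings k) \<le> (\<Sum>l\<in>bitstrings k. a l * b l + 3 * \<delta>)" by (intro sum_mono t_le)
  also have "\<dots> = T + 3 * 2 ^ k * \<delta>" by (simp add: sum.distrib T_def card_bitstrings)
  finally have st: "sum t (bitstrings k) \<le> T + 3 * 2 ^ k * \<delta>" .
  have "success k (power_pmf n (BY q)) (power_pmf n (BN q)) f g =
    (\<Sum>l\<in>bitstrings k. expect (BY q) n (\<lambda>w. f (fst \<circ> w) l * g (snd \<circ> w) l)) - T"
    by (simp add: success_def expect_dotp N_eq T_def)
  also have "\<dots> \<le> (\<Sum>l\<in>bitstrings k. t l powr s + \<epsilon>) - T"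
  proof (intro diff_right_mono sum_mono)
    fix l assume l: "l \<in> bitstrings k"
    have "t l powr s = (a l + \<delta>) powr s * (b l + \<delta>) powr s"
      using a01 [OF l] b01 [OF l] \<delta> by (simp add: t_def powr_mult)
    then show "expect (BY q) n (\<lambda>w. f (fst \<circ> w) l * g (snd \<circ> w) l) \<le> t l powr s + \<epsilon>"
      using bound [OF l] by (simp add: a_def b_def)
  qed
  also have "\<dots> = (\<Sum>l\<in>bitstrings k. t l powr s) + 2 ^ k * \<epsilon> - T"
    by (simp add: sum.distrib card_bitstrings)
  also have "(\<Sum>l\<in>bitstrings k. t l powr s) \<le> Q * (s * sum t (bitstrings k) + (1 - s))"
  proof -
    have "bitstrings k \<noteq> {}" using card_bitstrings [of k] by auto
    then show ?thesis unfolding Q_def using s01 t0 by (intro sum_powr_le) auto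
  qed
  also have "\<dots> \<le> (1 + u) * (1 * (T + 3 * 2 ^ k * \<delta>) + \<rho>)"
  proof (intro mult_mono add_mono Q s\<rho>)
    show "s \<le> 1" "sum t (bitstrings k) \<le> T + 3 * 2 ^ k * \<delta>" by (fact s01 st)+
    show "0 \<le> sum t (bitstrings k)" using t0 by (intro sum_nonneg) (auto intro: less_imp_le)
    then show "0 \<le> s * sum t (bitstrings k) + (1 - s)" using s01 by simp
  qed (use u in auto)
  also have "\<dots> = T + u * T + (1 + u) * (3 * 2 ^ k * \<delta>) + (1 + u) * \<rho>" by (simp add: algebra_simps)
  also have "\<dots> \<le> T + u * 1 + 2 * (3 * 2 ^ k * \<delta>) + 2 * u"
    using T u \<delta> \<rho>u \<rho>0 by (intro add_mono mult_left_mono mult_right_mono mult_mono) auto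
  finally show ?thesis by (simp add: algebra_simps)
qed

theorem theorem6p8:
  shows "\<exists>(k0 :: nat \<Rightarrow> real \<Rightarrow> real) (d :: nat \<Rightarrow> real \<Rightarrow> nat) (\<tau> :: nat \<Rightarrow> real \<Rightarrow> real).
    (\<forall>q\<ge>1. \<forall>\<epsilon>>0. \<tau> q \<epsilon> > 0) \<and>
    (\<forall>\<epsilon>>0. \<exists>c>0. \<forall>q\<ge>1. k0 q \<epsilon> \<ge> c * sqrt (real q)) \<and>
    (\<forall>\<epsilon>>0. \<forall>k\<ge>1. \<forall>q\<ge>1. \<forall>\<^sub>F n in sequentially.
       \<forall>f g. real k < k0 q \<epsilon> \<and> f \<in> cube n \<rightarrow> KA k \<and> g \<in> cube n \<rightarrow> KB k \<and>
             success k (power_pmf n (BY q)) (power_pmf n (BN q)) f g \<ge> \<epsilon> \<longrightarrow>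
         (\<exists>i<n.
            min (Max ((\<lambda>j. low_deg_influence (1 / real q) n (d q \<epsilon>) i (\<lambda>x. f x j)) ` bitstrings k))
                (Max ((\<lambda>j. low_deg_influence (1 / 2) n (d q \<epsilon>) i (\<lambda>y. g y j)) ` bitstrings k))
            \<ge> \<tau> q \<epsilon>))"
proof -
  define \<rho> where "\<rho> q = 0.95 / sqrt (real q - 1)" for q :: nat
  define u where "u \<epsilon> = min 1 (\<epsilon> / 12)" for \<epsilon> :: real
  define \<delta> where "\<delta> q \<epsilon> = min 1 (\<epsilon> / (24 * 2 ^ q))" for q :: nat and \<epsilon> :: real
  define bounded where "bounded q \<epsilon> d \<tau> \<longleftrightarrow> (\<forall>n f g.
    (\<forall>z\<in>cube n. f z \<in> {0..1}) \<longrightarrow> (\<forall>z\<in>cube n. g z \<in> {0..1}) \<longrightarrow>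
    (\<forall>i<n. low_deg_influence (1 / real q) n d i f < \<tau> \<or> low_deg_influence (1 / 2) n d i g < \<tau>) \<longrightarrow>
    expect (BY q) n (\<lambda>w. f (fst \<circ> w) * g (snd \<circ> w)) \<le>
      (coeff_hat (1 / real q) n f {} + \<delta> q \<epsilon>) powr (1 / (1 + \<rho> q)) *
      (coeff_hat (1 / 2) n g {} + \<delta> q \<epsilon>) powr (1 / (1 + \<rho> q)) + \<epsilon> / (4 * 2 ^ q))"
    for q :: nat and \<epsilon> :: real and d \<tau>
  have "\<exists>d \<tau>. \<tau> > 0 \<and> (2 \<le> q \<longrightarrow> 0 < \<epsilon> \<longrightarrow> bounded q \<epsilon> d \<tau>)" for q \<epsilon>
  proof (cases "2 \<le> q \<and> 0 < \<epsilon>")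
    case True
    then interpret correlated_bits "BY q" "1 / real q" "1 / 2" "\<rho> q"
      unfolding \<rho>_def by (intro correlated_bits_BY) simp
    define t where "t = sqrt (real q - 1)"
    have t: "1 \<le> t" using True by (simp add: t_def)
    have "\<rho> q = 0.95 / t" by (simp add: \<rho>_def t_def)
    with t have \<rho>: "0 \<le> \<rho> q" "\<rho> q < 1" by (simp_all add: divide_less_eq)
    have \<delta>: "0 < \<delta> q \<epsilon>" "\<delta> q \<epsilon> \<le> 1" "0 < \<epsilon> / (4 * 2 ^ q)" using True by (auto simp: \<delta>_def)
    have "\<exists>d. \<exists>\<tau>>0. bounded q \<epsilon> d \<tau>"
      unfolding bounded_def by (rule no_common_influence_bound [OF \<rho> \<delta>])
    then show ?thesis by blast
  next
    case False
    then show ?thesis by (intro exI [of _ 1] exI [of _ 0]) auto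
  qed
  then obtain d \<tau> where \<tau>: "\<tau> q \<epsilon> > 0" and bound: "2 \<le> q \<Longrightarrow> 0 < \<epsilon> \<Longrightarrow> bounded q \<epsilon> (d q \<epsilon>) (\<tau> q \<epsilon>)" for q \<epsilon>
    by metis
  have main: "\<exists>i<n. min (Max ((\<lambda>j. low_deg_influence (1 / real q) n (d q \<epsilon>) i (\<lambda>x. f x j)) ` bitstrings k))
                (Max ((\<lambda>j. low_deg_influence (1 / 2) n (d q \<epsilon>) i (\<lambda>y. g y j)) ` bitstrings k)) \<ge> \<tau> q \<epsilon>"
    if \<epsilon>: "0 < \<epsilon>" and k: "1 \<le> k" "real k < u \<epsilon> / 2 * sqrt (real q)" and q: "1 \<le> q"
      and f: "f \<in> cube n \<rightarrow> KA k" and g: "g \<in> cube n \<rightarrow> KB k"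
      and succ: "success k (power_pmf n (BY q)) (power_pmf n (BN q)) f g \<ge> \<epsilon>" for \<epsilon> k q n f g
  proof (rule ccontr)
    assume no: "\<not> ?thesis"
    have u: "0 \<le> u \<epsilon>" "u \<epsilon> \<le> 1" "3 * u \<epsilon> \<le> \<epsilon> / 4" using \<epsilon> by (auto simp: u_def)
    have "u \<epsilon> / 2 * sqrt (real q) \<le> 1 / 2 * sqrt (real q)" using u by (intro mult_right_mono) auto
    with k have k2: "real k < sqrt (real q) / 2" by simp
    have "q \<noteq> 1" using k k2 by auto
    with q have q2: "2 \<le> q" by simp
    have "sqrt (real q) \<le> real q" using q by (intro real_le_lsqrt) (auto simp: power2_eq_square)
    with k2 have kq: "k \<le> q" by simp
    have \<delta>: "0 < \<delta> q \<epsilon>" "\<delta> q \<epsilon> \<le> 1" using \<epsilon> by (auto simp: \<delta>_def)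
    have "success k (power_pmf n (BY q)) (power_pmf n (BN q)) f g \<le> 3 * u \<epsilon> + 2 ^ k * (6 * \<delta> q \<epsilon> + \<epsilon> / (4 * 2 ^ q))"
    proof (rule success_le [OF q2 k(1) less_imp_le [OF k(2)] u(1,2) \<delta> refl refl f g])
      fix l assume l: "l \<in> bitstrings k"
      have "low_deg_influence (1 / real q) n (d q \<epsilon>) i (\<lambda>x. f x l) < \<tau> q \<epsilon> \<or>
          low_deg_influence (1 / 2) n (d q \<epsilon>) i (\<lambda>y. g y l) < \<tau> q \<epsilon>" if "i < n" for i
      proof -
        have "low_deg_influence (1 / real q) n (d q \<epsilon>) i (\<lambda>x. f x l) \<le>
            Max ((\<lambda>j. low_deg_influence (1 / real q) n (d q \<epsilon>) i (\<lambda>x. f x j)) ` bitstrings k)"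
          "low_deg_influence (1 / 2) n (d q \<epsilon>) i (\<lambda>y. g y l) \<le>
            Max ((\<lambda>j. low_deg_influence (1 / 2) n (d q \<epsilon>) i (\<lambda>y. g y j)) ` bitstrings k)"
          using l by (auto intro: Max_ge)
        then show ?thesis using no that by (fastforce simp: not_le)
      qed
      moreover have "\<forall>z\<in>cube n. f z l \<in> {0..1}" "\<forall>z\<in>cube n. g z l \<in> {0..1}"
        using f g l KA_range KB_range by blast+
      ultimately show "expect (BY q) n (\<lambda>w. f (fst \<circ> w) l * g (snd \<circ> w) l) \<le>
        (coeff_hat (1 / real q) n (\<lambda>x. f x l) {} + \<delta> q \<epsilon>) powr (1 / (1 + 0.95 / sqrt (real q - 1))) *
        (coeff_hat (1 / 2) n (\<lambda>y. g y l) {} + \<delta> q \<epsilon>) powr (1 / (1 + 0.95 / sqrt (real q - 1))) + \<epsilon> / (4 * 2 ^ q)"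
        using bound [OF q2 \<epsilon>, unfolded bounded_def \<rho>_def, rule_format, of n "\<lambda>x. f x l" "\<lambda>y. g y l"] by simp
    qed
    also have "\<dots> \<le> \<epsilon> / 4 + 2 ^ q * (6 * (\<epsilon> / (24 * 2 ^ q)) + \<epsilon> / (4 * 2 ^ q))"
      using u kq \<epsilon> \<delta>(1) by (intro add_mono mult_mono power_increasing order_refl mult_left_mono)
        (auto simp: \<delta>_def)
    also have "\<dots> = 3 / 4 * \<epsilon>" by (simp add: field_simps)
    finally show False using succ \<epsilon> by linarith
  qed
  \<comment> \<open>Since \<open>u \<le> 1\<close>, there is no admissible \<open>k\<close> for \<open>q = 1\<close>, where \<^const>\<open>BY\<close> is unspecified.\<close>
  show ?thesis
  proof (rule exI [of _ "\<lambda>q \<epsilon>. u \<epsilon> / 2 * sqrt (real q)"], rule exI [of _ d], rule exI [of _ \<tau>], intro conjI allI impI)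
    show "\<tau> q \<epsilon> > 0" for q \<epsilon> by (rule \<tau>)
    show "\<exists>c>0. \<forall>q\<ge>1. u \<epsilon> / 2 * sqrt (real q) \<ge> c * sqrt (real q)" if "0 < \<epsilon>" for \<epsilon>
      using that by (intro exI [of _ "u \<epsilon> / 2"]) (auto simp: u_def)
  qed (rule always_eventually, intro allI impI, elim conjE, rule main; assumption)
qed

end
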